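(* Consider the translation action $X \mapsto z + X$ ($z \in \mathbb{F}_8$) of the additive group of $\mathbb{F}_8$ on $$H = \lbrace X \subseteq \mathbb{F}_8 : |X| \in \lbrace 0, 4, 8 \rbrace \rbrace .$$ For each orbit $\mathcal{O} \in \mathbb{F}_8 \backslash H$ there is an order $\mathbb{E}_{\mathcal{O}}$ of integral octonions containing $\mathbb{O}(\mathbb{Z})$ that can be described in any of the following three ways (in particular, the three descriptions give the same set): (a) $\mathbb{E}_{\mathcal{O}}$ is the $\mathbb{Z}$-span of $\lbrace e^z : z \in \mathbb{F}_8 \rbrace \cup \lbrace e^X/2 : X \in \mathcal{O} \rbrace$. (b) $\mathbb{E}_{\mathcal{O}}$ consists of all octonions in $\tfrac{1}{2}\mathbb{O}(\mathbb{Z})$ whose halving sets are in $\mathrm{span}(\mathcal{O})$. (c) Pick $X \in \mathcal{O}$. Then $\mathbb{E}_{\mathcal{O}}$ is the smallest $\mathbb{Z}$-subalgebra of $\mathbb{O}(\mathbb{Q})$ containing $\mathbb{O}(\mathbb{Z})$ and $e^X/2$. Thus the orders of integral octonions containing $\mathbb{O}(\mathbb{Z})$ are sixteen in number, and are in one-to-one correspondence with the sixteen orbits in $\mathbb{F}_8 \backslash H$ (via $\mathcal{O} \mapsto \mathbb{E}_{\mathcal{O}}$). In particular, for each $x \in \mathbb{F}_8^*$, the order $\mathbb{E}_{\mathcal{O}_x}$ is a maximal order, where $\mathcal{O}_x = \lbrace X \subseteq \mathbb{F}_8 : |X| = 4, \ \sum_{y \in X} y = x \rbrace$ (which is an orbit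 in $\mathbb{F}_8 \backslash H$).
   Context: $\mathbb{F}_8$ is the field with 8 elements, $\mathbb{F}_8^* = \mathbb{F}_8 - \lbrace 0 \rbrace$, and $\mathrm{tr}:\mathbb{F}_8 \to \mathbb{F}_2$ is $\mathrm{tr}(x) = x + x^2 + x^4$. For a commutative ring $R$, $\mathbb{O}(R)$ is the (non-associative) $R$-algebra that is free as an $R$-module with basis $\lbrace e^x : x \in \mathbb{F}_8 \rbrace$ and has $R$-bilinear multiplication $e^x e^y = (-1)^{\mathrm{tr}(y x^6)} e^{x+y}$. Its identity is $e^0$, and $R$ is identified with $R e^0$. We regard $\mathbb{O}(\mathbb{Z}) \subseteq \tfrac{1}{2}\mathbb{O}(\mathbb{Z}) \subseteq \mathbb{O}(\mathbb{Q})$; $\mathbb{O}(\mathbb{R})$ is the algebra of octonions. An octonion is called integral if it satisfies a monic polynomial in $\mathbb{Z}[t]$. An order of integral octonions containing $\mathbb{O}(\mathbb{Z})$ is a subring (additive subgroup closed under multiplication, not necessarily associative) of $\mathbb{O}(\mathbb{Q})$ which contains $\mathbb{O}(\mathbb{Z})$ and all of whose elements are integral; it is maximal if it is not properly contained in another order of integral octonions. For $a = \sum_{x \in \mathbb{F}_8} a_x e^x \in \mathbb{O}(\mathbb{Q})$, the halving set of $a$ is $\lbrace x \in \mathbb{F}_8 : a_x \notin \mathbb{Z} \rbrace$. For $X \subseteq \mathbb{F}_8$, $e^X = \sum_{x \in X} e^x$. For an orbit $\mathcal{O}$ of the $\mathbb{F}_8$-action on $H$, $\mathrm{span}(\mathcal{O})$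 is the smallest subset of the power set $2^{\mathbb{F}_8}$ that contains $\mathcal{O}$ and is closed under symmetric difference, i.e. the $\mathbb{F}_2$-linear span of $\mathcal{O}$ in the $\mathbb{F}_2$-vector space $2^{\mathbb{F}_8}$ whose addition is symmetric difference (so $\emptyset \in \mathrm{span}(\mathcal{O})$). *)

theory Defs
  imports "HOL-Analysis.Cartesian_Space" "HOL-Computational_Algebra.Polynomial"
begin

text \<open>
  The field with eight elements is a type variable \<open>'f :: {field, finite}\<close>, with the hypothesis
  \<open>CARD('f) = 8\<close> imposed in the theorem. The algebra of octonions over a commutative ring
  \<open>'r\<close> has underlying module \<open>('r, 'f) vec\<close>, the free module on the elements of \<open>'f\<close>.
  Its product is \<open>octo_mult\<close>, not the componentwise product that the library puts on vectors.
\<close>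

type_synonym ('r, 'f) octo = "('r, 'f) vec"

definition tr :: "'f::field \<Rightarrow> 'f" where
  "tr x = x + x ^ 2 + x ^ 4"

text \<open>In the field with eight elements the trace takes only the values 0 and 1, so the sign is
  \<open>(-1) ^ tr (y * x ^ 6)\<close>.\<close>

definition octo_sign :: "'f::field \<Rightarrow> 'f \<Rightarrow> 'r::comm_ring_1" where
  "octo_sign x y = (if tr (y * x ^ 6) = 0 then 1 else - 1)"

definition octo_e :: "'f::{field,finite} \<Rightarrow> ('r::comm_ring_1, 'f) octo" where
  "octo_e x = axis x 1"

definition octo_mult ::
    "('r::comm_ring_1, 'f::{field,finite}) octo \<Rightarrow> ('r, 'f) octo \<Rightarrow> ('r, 'f) octo" (infixl \<open>\<odot>\<close> 70) where
  "a \<odot> b = (\<Sum>x\<in>UNIV. \<Sum>y\<in>UNIV. (a $ x * b $ y) *s (octo_sign x y *s octo_e (x + y)))"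

primrec octo_power :: "('r::comm_ring_1, 'f::{field,finite}) octo \<Rightarrow> nat \<Rightarrow> ('r, 'f) octo" where
  "octo_power a 0 = octo_e 0"
| "octo_power a (Suc n) = a \<odot> octo_power a n"

definition integral_octonion :: "('r::comm_ring_1, 'f::{field,finite}) octo \<Rightarrow> bool" where
  "integral_octonion a \<longleftrightarrow>
     (\<exists>p :: int poly. lead_coeff p = 1 \<and>
        (\<Sum>i\<le>degree p. of_int (coeff p i) *s octo_power a i) = 0)"

definition OZ :: "(rat, 'f::{field,finite}) octo set" where
  "OZ = {a. \<forall>x. a $ x \<in> \<int>}"

definition half_OZ :: "(rat, 'f::{field,finite}) octo set" where
  "half_OZ = {a. 2 *s a \<in> OZ}"

definition octo_subring :: "('r::comm_ring_1, 'f::{field,finite}) octo set \<Rightarrow> bool" where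
  "octo_subring S \<longleftrightarrow>
     0 \<in> S \<and> (\<forall>a\<in>S. \<forall>b\<in>S. a + b \<in> S) \<and> (\<forall>a\<in>S. - a \<in> S) \<and> (\<forall>a\<in>S. \<forall>b\<in>S. a \<odot> b \<in> S)"

definition integral_order :: "(rat, 'f::{field,finite}) octo set \<Rightarrow> bool" where
  "integral_order S \<longleftrightarrow> octo_subring S \<and> OZ \<subseteq> S \<and> (\<forall>a\<in>S. integral_octonion a)"

definition maximal_integral_order :: "(rat, 'f::{field,finite}) octo set \<Rightarrow> bool" where
  "maximal_integral_order S \<longleftrightarrow> integral_order S \<and> \<not> (\<exists>T. integral_order T \<and> S \<subset> T)"

definition halving_set :: "(rat, 'f::{field,finite}) octo \<Rightarrow> 'f set" where
  "halving_set a = {x. a $ x \<notin> \<int>}"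

definition octo_e_set :: "'f::{field,finite} set \<Rightarrow> ('r::comm_ring_1, 'f) octo" where
  "octo_e_set X = (\<Sum>x\<in>X. octo_e x)"

definition half_e_set :: "'f::{field,finite} set \<Rightarrow> (rat, 'f) octo" where
  "half_e_set X = (1 / 2) *s octo_e_set X"

definition Hsets :: "'f::{field,finite} set set" where
  "Hsets = {X. card X \<in> {0, 4, 8}}"

definition translation_orbit :: "'f::{field,finite} set \<Rightarrow> 'f set set" where
  "translation_orbit X = {(+) z ` X | z. True}"

definition Horbits :: "'f::{field,finite} set set set" where
  "Horbits = translation_orbit ` Hsets"

text \<open>\<open>P hull S\<close> is the intersection of all sets containing \<open>S\<close> that satisfy \<open>P\<close>. The empty set
  belongs to \<open>orbit_span \<O>\<close> as soon as \<open>\<O>\<close> is nonempty, which every orbit is.\<close>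

definition orbit_span :: "'f::{field,finite} set set \<Rightarrow> 'f set set" where
  "orbit_span \<O> = (\<lambda>S. \<forall>X\<in>S. \<forall>Y\<in>S. sym_diff X Y \<in> S) hull \<O>"

text \<open>A subalgebra over the integers is the same thing as a subring.\<close>

definition generated_subalgebra :: "(rat, 'f::{field,finite}) octo set \<Rightarrow> (rat, 'f) octo set" where
  "generated_subalgebra S = octo_subring hull S"

definition int_span :: "(rat, 'f::{field,finite}) octo set \<Rightarrow> (rat, 'f) octo set" where
  "int_span = module.span (\<lambda>(k::int) v. of_int k *s v)"

lemma module_int_scale: "module (\<lambda>(k::int) (v :: (rat, 'f::{field,finite}) octo). of_int k *s v)"
  by unfold_locales (simp_all add: vec_eq_iff algebra_simps)

definition orbit_order :: "'f::{field,finite} set set \<Rightarrow> (rat, 'f) octo set" where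
  "orbit_order \<O> = int_span (range octo_e \<union> half_e_set ` \<O>)"

definition sum_orbit :: "'f::{field,finite} \<Rightarrow> 'f set set" where
  "sum_orbit x = {X. card X = 4 \<and> (\<Sum>y\<in>X. y) = x}"

lemma octo_e_mult:
  "octo_e x \<odot> octo_e y = (octo_sign x y *s octo_e (x + y) :: ('r::comm_ring_1, 'f::{field,finite}) octo)"
proof -
  have "(octo_e x $ i * octo_e y $ j :: 'r) *s v
      = (if i = x then if j = y then v else 0 else 0)" for i j and v :: "('r, 'f) octo"
    by (simp add: octo_e_def axis_def vec_eq_iff)
  then have "octo_e x \<odot> octo_e y = (\<Sum>i\<in>UNIV. \<Sum>j\<in>UNIV. if i = x then
      if j = y then octo_sign i j *s octo_e (i + j) else 0 else (0 :: ('r, 'f) octo))"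
    unfolding octo_mult_def by simp
  also have "\<dots> = (\<Sum>i\<in>UNIV. if i = x then \<Sum>j\<in>UNIV.
      if j = y then octo_sign i j *s octo_e (i + j) else 0 else (0 :: ('r, 'f) octo))"
    by (intro sum.cong) auto
  finally show ?thesis by simp
qed

end

theory Submission
  imports Defs
begin

text \<open>
  Write \<open>N a\<close> for the norm, the sum of the squares of the coordinates. The signs of the multiplication
  table satisfy one identity (\<open>octo_sign_exchange\<close>), which says that \<open>N\<close> is multiplicative, in
  polarized form (\<open>exchange_law\<close>). The quadratic equation of an octonion and the Moufang identity
  follow formally, as for every composition algebra.

  Let \<open>S\<close> be an order that contains the integral basis. The norm of an integral octonion is an integer
  (\<open>norm_integral\<close>); applied to \<open>a + e\<^sup>x\<close> this also makes \<open>2 a\<^sub>x\<close> an integer. So \<open>S\<close> consists of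
  half-integral octonions and is determined by its code, the set of the halving sets of its elements. The
  code is closed under symmetric difference and under translations, all its members have \<open>0\<close>, \<open>4\<close> or
  \<open>8\<close> elements, and consequently any two of them meet in an even number of elements. Conversely,
  half-integral octonions whose halving sets have such a size are integral. For the orbit of
  \<open>X \<in> Hsets\<close>, put \<open>h = e\<^sup>X / 2\<close>. Modulo integral octonions the generators of the orbit order are the
  \<open>h e\<^sup>u\<close>, and also the \<open>e\<^sup>w h\<close>. The Moufang identity expresses \<open>(h e\<^sup>u) (e\<^sup>w h)\<close> by \<open>h\<close> and the basis,
  so the orbit order is closed under multiplication (\<open>code_order_mult\<close>).

  It remains to see which codes occur. Four-element sets of sum \<open>0\<close> are the cosets of the subgroups of
  order four, and the others form one orbit for each sum \<open>x \<noteq> 0\<close>. If the code contains a set \<open>X\<close> of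
  nonzero sum, then the orthogonality to all translates of \<open>X\<close> forces every member into the span of the
  orbit of \<open>X\<close> (\<open>orthogonal_mem_orbit_span\<close>); this also gives the maximality of the seven orders with
  \<open>x \<noteq> 0\<close>. Otherwise the code consists of cosets, besides the empty and the full set. Cosets of two
  different subgroups are impossible, since the product of the corresponding octonions has a halving set
  of nonzero sum (\<open>halving_set_product_subgroups_4\<close>): the code of all cosets belongs to no order. Hence
  the code is the span of one orbit. The empty and the full set form one orbit each; there are seven
  orbits of cosets, and seven for the nonzero sums.
\<close>

section \<open>The trace on the field with eight elements\<close>

text \<open>The parameter carries only the type: it lets the lemmas below share the hypothesis on the
  cardinality.\<close>
locale field_eight =
  fixes dummy :: "'f::{field,finite} itself"
  assumes card_field: "CARD('f) = 8"
begin

lemma power_7: "x ^ 7 = 1" if "(x::'f) \<noteq> 0"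
proof -
  let ?P = "\<Prod>y\<in>UNIV - {0}. y :: 'f"
  have "?P = (\<Prod>y\<in>UNIV - {0}. x * y)"
    by (rule prod.reindex_bij_witness[of _ "\<lambda>y. x * y" "\<lambda>y. y / x"]) (use that in auto)
  also have "\<dots> = x ^ 7 * ?P"
    by (simp add: prod.distrib card_Diff_singleton card_field)
  finally show ?thesis by simp
qed

lemma power_8: "(x::'f) ^ 8 = x"
proof (cases "x = 0")
  case False
  have "x ^ 8 = x * x ^ 7" by (simp flip: power_Suc)
  with False show ?thesis by (simp add: power_7)
qed simp

lemma two_eq_0 [simp]: "(2::'f) = 0"
proof -
  have "(1::'f) = - 1" using power_8[of "- 1"] by simp
  then have "(1::'f) + 1 = 0" by (metis add.right_inverse)
  then show ?thesis by simp
qed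

lemma add_self [simp]: "(x::'f) + x = 0"
  by (metis mult_2 mult_zero_left two_eq_0)

lemma add_self_left [simp]: "(x::'f) + (x + y) = y"
  by (simp flip: add.assoc)

lemma uminus_eq_self [simp]: "- (x::'f) = x"
  by (rule minus_unique) simp

lemma diff_eq_add [simp]: "(x::'f) - y = x + y"
  by (metis diff_conv_add_uminus uminus_eq_self)

lemma add_eq_0_iff_eq [simp]: "(x::'f) + y = 0 \<longleftrightarrow> x = y"
  by (metis add_self add_left_cancel)

lemma add_eq_iff: "(x::'f) + y = z \<longleftrightarrow> y = x + z"
  by (metis add_self_left)

lemma square_add: "((x::'f) + y)\<^sup>2 = x\<^sup>2 + y\<^sup>2"
  by (simp add: power2_sum)

lemma power_4_add: "((x::'f) + y) ^ 4 = x ^ 4 + y ^ 4"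
proof -
  have "(x + y) ^ 4 = ((x + y)\<^sup>2)\<^sup>2" by simp
  also have "\<dots> = (x\<^sup>2)\<^sup>2 + (y\<^sup>2)\<^sup>2" by (simp only: square_add)
  finally show ?thesis by simp
qed

lemma power_6_add: "((x::'f) + y) ^ 6 = x ^ 6 + x ^ 4 * y\<^sup>2 + x\<^sup>2 * y ^ 4 + y ^ 6"
proof -
  have "(x + y) ^ 6 = (x + y) ^ 4 * (x + y)\<^sup>2" by (simp flip: power_add)
  also have "\<dots> = (x ^ 4 + y ^ 4) * (x\<^sup>2 + y\<^sup>2)" by (simp only: square_add power_4_add)
  also have "\<dots> = x ^ 6 + x ^ 4 * y\<^sup>2 + x\<^sup>2 * y ^ 4 + y ^ 6"
    by (simp add: algebra_simps flip: power_add)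
  finally show ?thesis .
qed

lemma power_ge_8: "(x::'f) ^ (n + 8) = x ^ (n + 1)"
  by (simp add: power_add power_8)

lemma tr_add: "tr ((x::'f) + y) = tr x + tr y"
  by (simp add: tr_def square_add power_4_add algebra_simps)

lemma tr_0 [simp]: "tr (0::'f) = 0"
  by (simp add: tr_def)

lemma tr_1 [simp]: "tr (1::'f) = 1"
  by (simp add: tr_def)

lemma tr_square: "tr ((x::'f)\<^sup>2) = tr x"
proof -
  have "(x\<^sup>2) ^ 4 = x" by (simp add: power_8 flip: power_mult)
  then show ?thesis by (simp add: tr_def ac_simps)
qed

lemma tr_cases: "tr (x::'f) = 0 \<or> tr x = 1"
proof -
  have "(tr x)\<^sup>2 = x\<^sup>2 + (x\<^sup>2)\<^sup>2 + (x ^ 4)\<^sup>2" by (simp only: tr_def square_add)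
  also have "\<dots> = tr x" by (simp add: tr_def power_8 ac_simps flip: power_mult)
  finally have "tr x * (tr x + 1) = 0" by (simp add: algebra_simps power2_eq_square)
  then show ?thesis by simp
qed

text \<open>The two mixed terms of \<open>s * (a + s) ^ 6\<close> are conjugate under the Frobenius map, so they
  have equal traces; only \<open>tr (s ^ 7) = 1\<close> survives.\<close>
lemma tr_composition:
  assumes "(s::'f) \<noteq> 0"
  shows "tr (s * a ^ 6) + tr (s * (a + s) ^ 6) = 1"
proof -
  have "(a\<^sup>2 * s ^ 5)\<^sup>2 = a ^ 4 * s ^ (2 + 8)" by (simp add: power_mult_distrib flip: power_mult)
  also have "\<dots> = a ^ 4 * s ^ 3" by (simp only: power_ge_8) simp
  finally have conj: "tr (a ^ 4 * s ^ 3) = tr (a\<^sup>2 * s ^ 5)" by (metis tr_square)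
  have "s * (a + s) ^ 6 = s * a ^ 6 + a ^ 4 * s ^ 3 + a\<^sup>2 * s ^ 5 + s ^ 7"
    unfolding power_6_add by (simp add: algebra_simps power_numeral_reduce)
  then show ?thesis using power_7[OF assms] conj by (simp add: tr_add add.assoc)
qed

text \<open>A subgroup of order four has index two.\<close>
lemma subgroup_4_complement:
  assumes "(p::'f) \<noteq> 0" "q \<notin> {0, p}" "u \<notin> {0, p, q, p + q}" "v \<notin> {0, p, q, p + q}"
  shows "u + v \<in> {0, p, q, p + q}"
proof -
  let ?V = "{0, p, q, p + q}"
  have V: "card ?V = 4" using assms(1,2) by auto
  have "?V \<inter> (+) u ` ?V = {}"
    using assms(1,2,3) by (auto simp: ac_simps)
  then have "card (?V \<union> (+) u ` ?V) = 8"
    by (simp only: card_Un_disjoint card_image V inj_on_add finite.intros finite_imageI)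
  then have "?V \<union> (+) u ` ?V = UNIV"
    by (metis card_field card_subset_eq finite_class.finite_UNIV subset_UNIV)
  then have "v \<in> (+) u ` ?V" using assms(4) by blast
  then show ?thesis by (auto simp: ac_simps)
qed

text \<open>The sixth power of a nonzero element is its inverse. The sum \<open>c\<close> of the inverses of the nonzero
  elements of the subgroup is not \<open>0\<close>, because it equals \<open>(p * q * (p + q))\<^sup>2\<close>.\<close>
lemma tr_subgroup_kernel:
  fixes p q r :: 'f
  assumes pq: "p \<noteq> 0" "q \<notin> {0, p}"
  defines "c \<equiv> p ^ 6 + q ^ 6 + (p + q) ^ 6"
  shows "tr (r * c) = 0 \<longleftrightarrow> r \<in> {0, p, q, p + q}"
proof -
  have "c = (p * q * (p + q))\<^sup>2"
    unfolding c_def power_6_add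
    by (simp add: power_mult_distrib square_add algebra_simps flip: power_add)
  then have c: "c \<noteq> 0" using pq by auto
  have self: "tr (x * x ^ 6) = 1" if "x \<noteq> 0" for x :: 'f
    using power_7[OF that] by (simp flip: power_Suc)
  have p: "tr (p * c) = 0"
    using tr_composition[of p q] self[of p] pq
    by (simp add: c_def distrib_left tr_add ac_simps)
  have q: "tr (q * c) = 0"
    using tr_composition[of q p] self[of q] pq
    by (simp add: c_def distrib_left tr_add ac_simps)
  have one: "tr (r * c) = 1" if r: "r \<notin> {0, p, q, p + q}" for r
  proof (rule ccontr)
    assume "tr (r * c) \<noteq> 1"
    then have rc: "tr (r * c) = 0" using tr_cases by blast
    \<comment> \<open>Then \<open>z \<mapsto> tr (z * c)\<close> vanishes on both cosets of the subgroup, hence everywhere.\<close>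
    have V: "tr (v * c) = 0" if "v \<in> {0, p, q, p + q}" for v
      using that p q by (auto simp: distrib_right tr_add)
    have "tr (v * c) = 0" for v
    proof (cases "v \<in> {0, p, q, p + q}")
      case False
      then have "tr ((r + v) * c) = 0" using V subgroup_4_complement[OF pq r] by blast
      then show ?thesis using rc by (simp add: distrib_right tr_add)
    qed (rule V)
    from this[of "inverse c"] show False using c by simp
  qed
  show ?thesis
  proof (cases "r \<in> {0, p, q, p + q}")
    case True
    then show ?thesis using p q by (auto simp: distrib_right tr_add)
  next
    case False
    then show ?thesis using one[OF False] by simp
  qed
qed

lemma tr_subgroup:
  assumes "(p::'f) \<noteq> 0" "q \<notin> {0, p}" "r \<notin> {0, p, q, p + q}"
  shows "tr (r * p ^ 6) + tr (r * q ^ 6) + tr (r * (p + q) ^ 6) = 1"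
  using tr_subgroup_kernel[OF assms(1,2), of r] assms(3)
    tr_cases[of "r * (p ^ 6 + q ^ 6 + (p + q) ^ 6)"]
  by (simp add: distrib_left tr_add)

end

section \<open>Octonion algebra\<close>

text \<open>This is the quadratic character \<open>t \<mapsto> (- 1) ^ tr t\<close> of the additive group.\<close>
definition chi :: "'f::field \<Rightarrow> 'r::comm_ring_1" where
  "chi t = (if tr t = 0 then 1 else - 1)"

definition octo_inner :: "('r::comm_ring_1, 'f::finite) octo \<Rightarrow> ('r, 'f) octo \<Rightarrow> 'r" where
  "octo_inner a b = (\<Sum>x\<in>UNIV. a $ x * b $ x)"

definition octo_conj :: "('r::comm_ring_1, 'f::{field,finite}) octo \<Rightarrow> ('r, 'f) octo" where
  "octo_conj a = (2 * a $ 0) *s octo_e 0 - a"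

lemma octo_sign_chi: "octo_sign x y = chi (y * x ^ 6)"
  by (simp add: octo_sign_def chi_def)

lemma octo_e_nth: "octo_e x $ y = (if x = y then 1 else 0)"
  by (auto simp: octo_e_def axis_def)

lemma octo_mult_nth:
  "(a \<odot> b) $ z = (\<Sum>x\<in>UNIV. a $ x * b $ (z - x) * octo_sign x (z - x))"
proof -
  have "(\<Sum>y\<in>UNIV. a $ x * b $ y * (octo_sign x y * (if x + y = z then 1 else 0)))
      = (\<Sum>y\<in>UNIV. if y = z - x then a $ x * b $ y * octo_sign x y else 0)" for x
    by (intro sum.cong) (auto simp: algebra_simps)
  then show ?thesis
    by (simp add: octo_mult_def sum_component octo_e_nth)
qed

lemma octo_mult_add_left: "(a + b) \<odot> c = a \<odot> c + b \<odot> c"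
  and octo_mult_add_right: "a \<odot> (b + c) = a \<odot> b + a \<odot> c"
  and octo_mult_diff_left: "(a - b) \<odot> c = a \<odot> c - b \<odot> c"
  and octo_mult_diff_right: "a \<odot> (b - c) = a \<odot> b - a \<odot> c"
  and octo_mult_scale_left: "(k *s a) \<odot> c = k *s (a \<odot> c)"
  and octo_mult_scale_right: "a \<odot> (k *s c) = k *s (a \<odot> c)"
  by (simp_all add: vec_eq_iff octo_mult_nth algebra_simps sum.distrib sum_subtractf sum_distrib_left)

lemma octo_mult_zero_left: "0 \<odot> c = 0"
  and octo_mult_zero_right: "a \<odot> 0 = 0"
  by (simp_all add: vec_eq_iff octo_mult_nth)

lemma octo_mult_sum_left: "sum f A \<odot> c = (\<Sum>i\<in>A. f i \<odot> c)"
  by (induction A rule: infinite_finite_induct) (simp_all add: octo_mult_zero_left octo_mult_add_left)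

lemma octo_mult_sum_right: "a \<odot> sum f A = (\<Sum>i\<in>A. a \<odot> f i)"
  by (induction A rule: infinite_finite_induct) (simp_all add: octo_mult_zero_right octo_mult_add_right)

lemma octo_expansion: "a = (\<Sum>x\<in>UNIV. (a $ x) *s octo_e x)"
  by (simp add: vec_eq_iff sum_component octo_e_nth if_distrib cong: if_cong)

lemma octo_inner_commute: "octo_inner a b = octo_inner b a"
  by (simp add: octo_inner_def mult.commute)

lemma octo_inner_simps:
  "octo_inner (a + b) c = octo_inner a c + octo_inner b c"
  "octo_inner a (b + c) = octo_inner a b + octo_inner a c"
  "octo_inner (a - b) c = octo_inner a c - octo_inner b c"
  "octo_inner a (b - c) = octo_inner a b - octo_inner a c"
  "octo_inner (k *s a) c = k * octo_inner a c"
  "octo_inner a (k *s c) = k * octo_inner a c"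
  by (simp_all add: octo_inner_def algebra_simps sum.distrib sum_subtractf sum_distrib_left)

lemma octo_inner_e_left [simp]: "octo_inner (octo_e x) a = a $ x"
  by (simp add: octo_inner_def octo_e_nth if_distrib[of "\<lambda>u. u * _"] cong: if_cong)

lemma octo_inner_e_right [simp]: "octo_inner a (octo_e x) = a $ x"
  by (simp add: octo_inner_commute[of a])

lemma octo_inner_eqI: "(\<And>t. octo_inner a t = octo_inner b t) \<Longrightarrow> a = b"
  for a b :: "('r::comm_ring_1, 'f::{field,finite}) octo"
  unfolding vec_eq_iff by (metis octo_inner_e_right)

lemma octo_conj_conj [simp]: "octo_conj (octo_conj a) = a"
  by (simp add: octo_conj_def vec_eq_iff octo_e_nth)

lemma octo_inner_conj: "octo_inner (octo_conj a) b = octo_inner a (octo_conj b)"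
  by (simp add: octo_conj_def octo_inner_simps algebra_simps)

context field_eight
begin

lemma chi_add: "(chi ((s::'f) + t) :: 'r::comm_ring_1) = chi s * chi t"
  using tr_cases[of s] tr_cases[of t] by (auto simp: chi_def tr_add)

lemma octo_sign_0 [simp]: "octo_sign (0::'f) y = 1" "octo_sign x (0::'f) = 1"
  by (simp_all add: octo_sign_chi chi_def)

lemma octo_one_left [simp]: "octo_e (0::'f) \<odot> a = a"
  by (simp add: vec_eq_iff octo_mult_nth octo_e_nth if_distrib[of "\<lambda>u. u * _"] cong: if_cong)

lemma octo_one_right [simp]: "a \<odot> octo_e (0::'f) = a"
proof -
  have "a $ x * octo_e 0 $ (z - x) * octo_sign x (z - x) = (if x = z then a $ x else 0)" for x z
    by (simp add: octo_e_nth)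
  then show ?thesis by (simp add: vec_eq_iff octo_mult_nth del: diff_eq_add)
qed

text \<open>The products \<open>e\<^sup>x e\<^sup>u\<close> and \<open>e\<^sup>y e\<^sup>v\<close> land on the same basis vector exactly when
  \<open>e\<^sup>x e\<^sup>v\<close> and \<open>e\<^sup>y e\<^sup>u\<close> do, and the two sign products are opposite unless \<open>x = y\<close>.\<close>
lemma octo_sign_exchange:
  fixes x y z :: 'f
  shows "octo_sign x (x + z) * octo_sign y (y + z) + octo_sign x (y + z) * octo_sign y (x + z)
      = (if x = y then 2 else 0 :: 'r::comm_ring_1)"
proof -
  define A B C D where "A = tr (x * x ^ 6)" and "B = tr (y * x ^ 6)" and "C = tr (x * y ^ 6)"
    and "D = tr (y * y ^ 6)"
  have sq: "(chi t :: 'r) * chi t = 1" for t :: 'f by (simp add: chi_def)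
  show ?thesis
  proof (cases "x = y")
    case True
    then show ?thesis by (simp add: octo_sign_chi sq)
  next
    case False
    have "tr ((x + y) * x ^ 6 + (x + y) * y ^ 6) = 1"
      using tr_composition[of "x + y" x] False by (simp add: tr_add)
    then have m1: "(chi ((x + y) * x ^ 6 + (x + y) * y ^ 6) :: 'r) = - 1"
      by (simp add: chi_def)
    have "(x + z) * x ^ 6 + (y + z) * y ^ 6
        = ((x + y) * x ^ 6 + (x + y) * y ^ 6) + ((y + z) * x ^ 6 + (x + z) * y ^ 6)"
      by (simp add: algebra_simps)
    then have "(chi ((x + z) * x ^ 6) * chi ((y + z) * y ^ 6) :: 'r)
        = - (chi ((y + z) * x ^ 6) * chi ((x + z) * y ^ 6))"
      using m1 by (metis chi_add mult_minus1)
    then show ?thesis using False by (simp add: octo_sign_chi)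
  qed
qed

text \<open>This is the full polarization of \<open>N (a b) = N a * N b\<close>, the norm being
  \<open>N a = octo_inner a a\<close>. The adjunction rules, the quadratic equation and the Moufang
  identity below are consequences.\<close>
lemma exchange_law:
  fixes a b c d :: "('r::comm_ring_1, 'f) octo"
  shows "octo_inner (a \<odot> b) (c \<odot> d) + octo_inner (a \<odot> d) (c \<odot> b)
    = 2 * octo_inner a c * octo_inner b d"
proof -
  let ?s = "octo_sign :: 'f \<Rightarrow> 'f \<Rightarrow> 'r"
  have expand: "octo_inner (a \<odot> b) (c \<odot> d) = (\<Sum>x\<in>UNIV. \<Sum>y\<in>UNIV. \<Sum>z\<in>UNIV.
      a $ x * c $ y * (b $ (x + z) * d $ (y + z)) * (?s x (x + z) * ?s y (y + z)))" for b d
  proof -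
    have "octo_inner (a \<odot> b) (c \<odot> d) = (\<Sum>z\<in>UNIV. \<Sum>x\<in>UNIV. \<Sum>y\<in>UNIV.
      a $ x * c $ y * (b $ (x + z) * d $ (y + z)) * (?s x (x + z) * ?s y (y + z)))"
      unfolding octo_inner_def octo_mult_nth sum_product
      by (intro sum.cong refl) (simp add: ac_simps)
    also have "\<dots> = (\<Sum>x\<in>UNIV. \<Sum>z\<in>UNIV. \<Sum>y\<in>UNIV.
      a $ x * c $ y * (b $ (x + z) * d $ (y + z)) * (?s x (x + z) * ?s y (y + z)))"
      by (rule sum.swap)
    also have "\<dots> = (\<Sum>x\<in>UNIV. \<Sum>y\<in>UNIV. \<Sum>z\<in>UNIV.
      a $ x * c $ y * (b $ (x + z) * d $ (y + z)) * (?s x (x + z) * ?s y (y + z)))"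
      by (intro sum.cong refl sum.swap)
    finally show ?thesis .
  qed
  have shift: "(\<Sum>z\<in>UNIV. g (x + z) (y + z)) = (\<Sum>z\<in>UNIV. g (y + z) (x + z))"
    for g :: "'f \<Rightarrow> 'f \<Rightarrow> 'r" and x y
    by (rule sum.reindex_bij_witness[of _ "\<lambda>z. x + y + z" "\<lambda>z. x + y + z"]) (simp_all add: ac_simps)
  have "octo_inner (a \<odot> d) (c \<odot> b) = (\<Sum>x\<in>UNIV. \<Sum>y\<in>UNIV. \<Sum>z\<in>UNIV.
      a $ x * c $ y * (b $ (x + z) * d $ (y + z)) * (?s x (y + z) * ?s y (x + z)))"
    unfolding expand
  proof (rule sum.cong[OF refl], rule sum.cong[OF refl])
    fix x y :: 'f
    show "(\<Sum>z\<in>UNIV. a $ x * c $ y * (d $ (x + z) * b $ (y + z)) * (?s x (x + z) * ?s y (y + z)))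
      = (\<Sum>z\<in>UNIV. a $ x * c $ y * (b $ (x + z) * d $ (y + z)) * (?s x (y + z) * ?s y (x + z)))"
      using shift[of "\<lambda>u v. a $ x * c $ y * (d $ u * b $ v) * (?s x u * ?s y v)" x y]
      by (simp add: ac_simps)
  qed
  then have "octo_inner (a \<odot> b) (c \<odot> d) + octo_inner (a \<odot> d) (c \<odot> b)
    = (\<Sum>x\<in>UNIV. \<Sum>y\<in>UNIV. \<Sum>z\<in>UNIV. a $ x * c $ y * (b $ (x + z) * d $ (y + z)) *
        (?s x (x + z) * ?s y (y + z) + ?s x (y + z) * ?s y (x + z)))"
    by (simp only: expand[of b d] sum.distrib[symmetric] distrib_left)
  also have "\<dots> = (\<Sum>x\<in>UNIV. \<Sum>y\<in>UNIV. if x = y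
      then \<Sum>z\<in>UNIV. 2 * (a $ x * c $ x) * (b $ (x + z) * d $ (x + z)) else 0)"
    unfolding octo_sign_exchange by (intro sum.cong refl) (auto intro!: sum.cong)
  also have "\<dots> = (\<Sum>x\<in>UNIV. \<Sum>z\<in>UNIV. 2 * (a $ x * c $ x) * (b $ (x + z) * d $ (x + z)))"
    by simp
  also have "\<dots> = (\<Sum>x\<in>UNIV. \<Sum>z\<in>UNIV. 2 * (a $ x * c $ x) * (b $ z * d $ z))"
  proof (rule sum.cong[OF refl])
    fix x :: 'f
    show "(\<Sum>z\<in>UNIV. 2 * (a $ x * c $ x) * (b $ (x + z) * d $ (x + z)))
        = (\<Sum>z\<in>UNIV. 2 * (a $ x * c $ x) * (b $ z * d $ z))"
      by (rule sum.reindex_bij_witness[of _ "(+) x" "(+) x"]) simp_all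
  qed
  also have "\<dots> = 2 * octo_inner a c * octo_inner b d"
    by (simp only: octo_inner_def mult.assoc[of 2] sum_product) (simp only: sum_distrib_left)
  finally show ?thesis .
qed

text \<open>Multiplication by \<open>conj a\<close> is adjoint to multiplication by \<open>a\<close>: this is the exchange law with
  one factor equal to the identity, and \<open>conj a = 2 a\<^sub>0 - a\<close>.\<close>
lemma inner_mult_left: "octo_inner (a \<odot> b) c = octo_inner b (octo_conj a \<odot> c)"
  for a b c :: "('r::comm_ring_1, 'f) octo"
  using exchange_law[of a b "octo_e 0" c]
  by (simp add: octo_conj_def octo_mult_diff_left octo_mult_scale_left octo_inner_simps
      octo_inner_commute algebra_simps)

lemma inner_mult_right: "octo_inner (a \<odot> b) c = octo_inner a (c \<odot> octo_conj b)"
  for a b c :: "('r::comm_ring_1, 'f) octo"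
  using exchange_law[of a b c "octo_e 0"]
  by (simp add: octo_conj_def octo_mult_diff_right octo_mult_scale_right octo_inner_simps
      octo_inner_commute algebra_simps)

lemma octo_conj_mult: "octo_conj (a \<odot> b) = octo_conj b \<odot> octo_conj a"
  for a b :: "('r::comm_ring_1, 'f) octo"
proof (rule octo_inner_eqI)
  fix t
  have "octo_inner (octo_conj (a \<odot> b)) t = octo_inner b (octo_conj a \<odot> octo_conj t)"
    by (simp add: octo_inner_conj inner_mult_left)
  also have "\<dots> = octo_inner (octo_conj a) (b \<odot> t)"
    by (metis inner_mult_right octo_inner_commute octo_conj_conj)
  also have "\<dots> = octo_inner (octo_conj b \<odot> octo_conj a) t"
    by (simp add: inner_mult_left)
  finally show "octo_inner (octo_conj (a \<odot> b)) t = octo_inner (octo_conj b \<odot> octo_conj a) t" .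
qed

text \<open>The scalars are rational numbers from here on, because setting \<open>c = a\<close> in the exchange law
  leaves a factor two to be cancelled.\<close>
lemma conj_mult_mult: "octo_conj a \<odot> (a \<odot> b) = octo_inner a a *s b"
  for a b :: "(rat, 'f) octo"
proof (rule octo_inner_eqI)
  fix t
  have "octo_inner (octo_conj a \<odot> (a \<odot> b)) t = octo_inner (a \<odot> b) (a \<odot> t)"
    by (simp add: inner_mult_left)
  also have "\<dots> = octo_inner a a * octo_inner b t"
    using exchange_law[of a b a t] by (simp add: octo_inner_commute)
  finally show "octo_inner (octo_conj a \<odot> (a \<odot> b)) t = octo_inner (octo_inner a a *s b) t"
    by (simp add: octo_inner_simps)
qed

lemma mult_conj_mult: "a \<odot> (octo_conj a \<odot> b) = octo_inner a a *s b"
  for a b :: "(rat, 'f) octo"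
  using conj_mult_mult[of "octo_conj a" b] octo_inner_conj[of a "octo_conj a"] by simp

lemma octo_square: "a \<odot> a = (2 * a $ 0) *s a - octo_inner a a *s octo_e 0"
  for a :: "(rat, 'f) octo"
  using conj_mult_mult[of a "octo_e 0"]
  by (simp add: octo_conj_def octo_mult_diff_left octo_mult_scale_left algebra_simps)

text \<open>This is the Moufang identity \<open>(x y) (z x) = x (y z) x\<close>, with the right hand side
  evaluated. The product thus lies in the span of \<open>x\<close> and \<open>conj (y z)\<close>, which is what makes
  the order generated by one half-integral octonion small.\<close>
lemma moufang:
  fixes x y z :: "(rat, 'f) octo"
  shows "(x \<odot> y) \<odot> (z \<odot> x) = (2 * octo_inner (x \<odot> y) (octo_conj z)) *s x
      - octo_inner x x *s (octo_conj z \<odot> octo_conj y)"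
proof (rule octo_inner_eqI)
  fix t
  let ?w = "octo_conj x \<odot> octo_conj z"
  have "octo_inner ((x \<odot> y) \<odot> (z \<odot> x)) t = octo_inner (x \<odot> y) (t \<odot> ?w)"
    by (simp add: inner_mult_right octo_conj_mult)
  also have "\<dots> = 2 * octo_inner x t * octo_inner y ?w - octo_inner (x \<odot> ?w) (t \<odot> y)"
    using exchange_law[of x y t ?w] by simp
  also have "octo_inner y ?w = octo_inner (x \<odot> y) (octo_conj z)"
    by (simp add: inner_mult_left)
  also have "octo_inner (x \<odot> ?w) (t \<odot> y) = octo_inner x x * octo_inner (octo_conj z \<odot> octo_conj y) t"
    by (simp add: mult_conj_mult octo_inner_simps inner_mult_right[of "octo_conj z"])
  finally show "octo_inner ((x \<odot> y) \<odot> (z \<odot> x)) t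
      = octo_inner ((2 * octo_inner (x \<odot> y) (octo_conj z)) *s x
        - octo_inner x x *s (octo_conj z \<odot> octo_conj y)) t"
    by (simp add: octo_inner_simps)
qed

end

section \<open>Half-integral octonions and integrality\<close>

text \<open>If \<open>r = p / q\<close> in lowest terms, then every power of \<open>q\<close> divides \<open>D\<close>.\<close>
lemma rat_int_of_bounded_denominators:
  fixes r :: rat and D :: int
  assumes "D \<noteq> 0" and int: "\<And>n. of_int D * r ^ n \<in> \<int>"
  shows "r \<in> \<int>"
proof -
  obtain p q where pq: "quotient_of r = (p, q)" by fastforce
  then have q: "q > 0" and cop: "coprime p q" and r: "r = of_int p / of_int q"
    by (auto simp: quotient_of_denom_pos quotient_of_coprime quotient_of_div)
  have dvd: "q ^ n dvd D" for n
  proof -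
    obtain k where "of_int D * r ^ n = of_int k" using int[of n] by (auto elim: Ints_cases)
    then have "of_int (D * p ^ n) = (of_int (k * q ^ n) :: rat)"
      using q by (simp add: r field_simps)
    then have "q ^ n dvd D * p ^ n" by (simp only: of_int_eq_iff) simp
    then show ?thesis
      using cop by (simp add: coprime_dvd_mult_left_iff coprime_commute)
  qed
  have "q = 1"
  proof (rule ccontr)
    assume "q \<noteq> 1"
    then have "\<bar>D\<bar> < 2 ^ nat \<bar>D\<bar>" "2 \<le> q"
      using q of_nat_less_two_power[of "nat \<bar>D\<bar>", where ?'a = int] by simp_all
    then have "\<bar>D\<bar> < q ^ nat \<bar>D\<bar>"
      using power_mono[of 2 q "nat \<bar>D\<bar>"] by simp
    then show False
      using dvd_imp_le_int[OF \<open>D \<noteq> 0\<close> dvd[of "nat \<bar>D\<bar>"]] q by simp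
  qed
  then show ?thesis by (simp add: r)
qed

lemma common_denominator:
  assumes "finite (A :: rat set)"
  obtains D :: int where "D \<noteq> 0" "\<And>r. r \<in> A \<Longrightarrow> of_int D * r \<in> \<int>"
  using assms
proof (induction A arbitrary: thesis rule: finite_induct)
  case empty
  then show ?case by (metis empty_iff zero_neq_one)
next
  case (insert s A)
  obtain D where D: "D \<noteq> 0" "\<And>r. r \<in> A \<Longrightarrow> of_int D * r \<in> \<int>"
    using insert.IH by blast
  obtain p q where pq: "quotient_of s = (p, q)" by fastforce
  then have q: "q > 0" and s: "of_int q * s = of_int p"
    by (auto simp: quotient_of_denom_pos quotient_of_div[OF pq] less_imp_neq)
  show ?case
  proof (rule insert.prems)
    show "q * D \<noteq> 0" using D q by simp
    show "of_int (q * D) * r \<in> \<int>" if "r \<in> insert s A" for r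
    proof (cases "r = s")
      case True
      then have "of_int (q * D) * r = of_int (D * p)" using s by (simp add: ac_simps)
      then show ?thesis by (metis Ints_of_int)
    next
      case False
      then have "of_int q * (of_int D * r) \<in> \<int>"
        using that by (intro Ints_mult[OF Ints_of_int D(2)]) auto
      then show ?thesis by (simp add: mult.assoc)
    qed
  qed
qed

lemma half_integer_cases:
  assumes "2 * u \<in> (\<int> :: rat set)"
  obtains m where "u = of_int m" "u \<in> \<int>" | m where "u = of_int m + 1 / 2" "u \<notin> \<int>"
proof -
  obtain k where k: "2 * u = of_int k" using assms by (auto elim: Ints_cases)
  show thesis
  proof (cases "even k")
    case True
    then obtain m where "k = 2 * m" by blast
    then show thesis using k that(1)[of m] by simp
  next
    case False
    then obtain m where m: "k = 2 * m + 1" by (auto elim: oddE)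
    have "u \<notin> \<int>"
    proof
      assume "u \<in> \<int>"
      then obtain l where "u = of_int l" by (auto elim: Ints_cases)
      then have "of_int (2 * l) = (of_int k :: rat)" using k by simp
      then have "2 * l = k" by (simp only: of_int_eq_iff)
      then show False using False by auto
    qed
    then show thesis using k m that(2)[of m] by (simp add: field_simps)
  qed
qed

lemma half_integer_add:
  assumes "2 * u \<in> (\<int> :: rat set)" "2 * v \<in> \<int>"
  shows "u + v \<in> \<int> \<longleftrightarrow> (u \<in> \<int> \<longleftrightarrow> v \<in> \<int>)"
proof (cases "u \<in> \<int>")
  case True
  then show ?thesis by (metis Ints_add Ints_diff add_diff_cancel_left')
next
  case False
  then obtain m where m: "u = of_int m + 1 / 2" using assms(1) by (auto elim: half_integer_cases)
  show ?thesis
  proof (cases "v \<in> \<int>")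
    case True
    then show ?thesis using False by (metis Ints_diff add_diff_cancel_right')
  next
    case v: False
    then obtain n where "v = of_int n + 1 / 2" using assms(2) by (auto elim: half_integer_cases)
    then have "u + v = of_int (m + n + 1)" using m by simp
    then show ?thesis using v False by (metis Ints_of_int)
  qed
qed

lemma OZ_iff: "a \<in> OZ \<longleftrightarrow> (\<forall>x. a $ x \<in> \<int>)"
  by (simp add: OZ_def)

lemma half_OZ_iff: "a \<in> half_OZ \<longleftrightarrow> (\<forall>x. 2 * a $ x \<in> \<int>)"
  by (simp add: half_OZ_def OZ_def)

lemma halving_set_iff: "x \<in> halving_set a \<longleftrightarrow> a $ x \<notin> \<int>"
  by (simp add: halving_set_def)

lemma halving_set_empty_iff: "halving_set a = {} \<longleftrightarrow> a \<in> OZ"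
  by (auto simp: halving_set_def OZ_def)

lemma OZ_subset_half_OZ: "a \<in> OZ \<Longrightarrow> a \<in> half_OZ"
  by (simp add: OZ_iff half_OZ_iff)

lemma octo_e_OZ: "octo_e x \<in> OZ"
  by (simp add: OZ_iff octo_e_nth)

lemma half_OZ_add: "a \<in> half_OZ \<Longrightarrow> b \<in> half_OZ \<Longrightarrow> a + b \<in> half_OZ"
  by (simp add: half_OZ_iff distrib_left)

lemma half_OZ_minus: "a \<in> half_OZ \<Longrightarrow> - a \<in> half_OZ"
  by (simp add: half_OZ_iff)

lemma halving_set_minus: "halving_set (- a) = halving_set a"
  by (simp add: halving_set_def)

lemma halving_set_add:
  "a \<in> half_OZ \<Longrightarrow> b \<in> half_OZ \<Longrightarrow> halving_set (a + b) = sym_diff (halving_set a) (halving_set b)"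
  by (auto simp: halving_set_iff half_OZ_iff half_integer_add)

lemma half_e_set_nth: "half_e_set X $ x = (if x \<in> X then 1 / 2 else 0)"
  by (simp add: half_e_set_def octo_e_set_def sum_component octo_e_nth)

lemma half_e_set_half_OZ: "half_e_set X \<in> half_OZ"
  by (simp add: half_OZ_iff half_e_set_nth)

lemma halving_set_half_e_set [simp]: "halving_set (half_e_set X) = X"
proof -
  have "(1 / 2 :: rat) \<notin> \<int>"
  proof
    assume "(1 / 2 :: rat) \<in> \<int>"
    then obtain k where "(1 / 2 :: rat) = of_int k" by (auto elim: Ints_cases)
    then have "(of_int (2 * k) :: rat) = of_int 1" by simp
    then have "2 * k = 1" by (simp only: of_int_eq_iff)
    then show False by presburger
  qed
  then show ?thesis by (auto simp: halving_set_iff half_e_set_nth split: if_splits)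
qed

lemma diff_OZ_if_halving_set_eq:
  assumes "a \<in> half_OZ" "b \<in> half_OZ" "halving_set a = halving_set b"
  shows "a - b \<in> OZ"
  using halving_set_add[OF assms(1) half_OZ_minus[OF assms(2)]] assms(3)
  by (simp add: halving_set_minus flip: halving_set_empty_iff)

text \<open>The square of a half-integer that is not an integer is \<open>1 / 4\<close> modulo \<open>1\<close>.\<close>
lemma half_OZ_norm_iff:
  fixes a :: "(rat, 'f::{field,finite}) octo"
  assumes "a \<in> half_OZ"
  shows "octo_inner a a \<in> \<int> \<longleftrightarrow> 4 dvd card (halving_set a)"
proof -
  have "a $ x * a $ x - (if x \<in> halving_set a then 1 / 4 else 0) \<in> \<int>" for x
  proof -
    have "2 * a $ x \<in> \<int>" using assms by (simp add: half_OZ_iff)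
    then show ?thesis
    proof (cases rule: half_integer_cases)
      case (2 m)
      then have "a $ x * a $ x - 1 / 4 = of_int (m * m + m)" by (simp add: algebra_simps)
      then show ?thesis using 2 by (simp add: halving_set_iff del: of_int_add of_int_mult)
    qed (simp add: halving_set_iff)
  qed
  then have "(\<Sum>x\<in>UNIV. a $ x * a $ x - (if x \<in> halving_set a then 1 / 4 else 0)) \<in> \<int>"
    by (intro Ints_sum) auto
  then have diff: "octo_inner a a - of_nat (card (halving_set a)) / 4 \<in> \<int>"
    by (simp add: octo_inner_def sum_subtractf flip: sum.inter_filter)
  have "octo_inner a a \<in> \<int> \<longleftrightarrow> (of_nat (card (halving_set a)) / 4 :: rat) \<in> \<int>"
    using diff by (metis Ints_add Ints_diff diff_add_cancel diff_diff_eq2 add_diff_cancel_left')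
  also have "\<dots> \<longleftrightarrow> 4 dvd card (halving_set a)"
  proof
    assume "(of_nat (card (halving_set a)) / 4 :: rat) \<in> \<int>"
    then obtain k :: int where "of_nat (card (halving_set a)) / 4 = (of_int k :: rat)"
      by (auto elim: Ints_cases)
    then have "of_int (int (card (halving_set a))) = (of_int (4 * k) :: rat)"
      by (simp add: field_simps)
    then have "int (card (halving_set a)) = 4 * k" by (simp only: of_int_eq_iff)
    then show "4 dvd card (halving_set a)" by presburger
  qed (auto elim!: dvdE)
  finally show ?thesis .
qed

context field_eight
begin

lemma norm_mult: "octo_inner (a \<odot> b) (a \<odot> b) = octo_inner a a * octo_inner b b"
  for a b :: "(rat, 'f) octo"
  using exchange_law[of a b a b] by simp

lemma norm_power: "octo_inner (octo_power a n) (octo_power a n) = octo_inner a a ^ n"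
  for a :: "(rat, 'f) octo"
  by (induction n) (simp_all add: norm_mult octo_e_nth)

text \<open>The powers of an integral octonion are integral combinations of finitely many of them, so
  they have a common denominator; the norm being multiplicative, so have the powers of the norm.\<close>
lemma norm_integral:
  fixes a :: "(rat, 'f) octo"
  assumes "integral_octonion a"
  shows "octo_inner a a \<in> \<int>"
proof -
  obtain p :: "int poly" where lead: "coeff p (degree p) = 1"
    and root: "(\<Sum>i\<le>degree p. of_int (coeff p i) *s octo_power a i) = 0"
    using assms by (auto simp: integral_octonion_def)
  let ?d = "degree p"
  have shifted: "(\<Sum>i\<le>?d. of_int (coeff p i) *s octo_power a (i + n)) = 0" for n
  proof (induction n)
    case (Suc n)
    have "(\<Sum>i\<le>?d. of_int (coeff p i) *s octo_power a (i + Suc n))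
        = a \<odot> (\<Sum>i\<le>?d. of_int (coeff p i) *s octo_power a (i + n))"
      by (simp add: octo_mult_sum_right octo_mult_scale_right)
    then show ?case by (simp only: Suc octo_mult_zero_right)
  qed (use root in simp)
  let ?A = "(\<lambda>(i, x). octo_power a i $ x) ` ({..<?d} \<times> UNIV)"
  obtain D :: int where D: "D \<noteq> 0" "\<And>r. r \<in> ?A \<Longrightarrow> of_int D * r \<in> \<int>"
    using common_denominator[of ?A] by auto
  have bounded: "of_int D * octo_power a n $ x \<in> \<int>" for n x
  proof (induction n rule: less_induct)
    case (less n)
    show ?case
    proof (cases "n < ?d")
      case True
      then show ?thesis by (intro D) auto
    next
      case False
      then obtain m where n: "n = ?d + m" by (metis le_Suc_ex not_less)
      have "(\<Sum>i<?d. of_int (coeff p i) *s octo_power a (i + m)) + octo_power a n = 0"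
        using shifted[of m] lead n by (simp flip: lessThan_Suc_atMost)
      then have "octo_power a n = - (\<Sum>i<?d. of_int (coeff p i) *s octo_power a (i + m))"
        by (simp add: add_eq_0_iff)
      then have "of_int D * octo_power a n $ x
          = - (\<Sum>i<?d. of_int (coeff p i) * (of_int D * octo_power a (i + m) $ x))"
        by (simp add: sum_component sum_distrib_left ac_simps)
      also have "\<dots> \<in> \<int>"
      proof (intro Ints_minus Ints_sum)
        fix i assume "i \<in> {..<?d}"
        then have "of_int D * octo_power a (i + m) $ x \<in> \<int>" using n by (intro less) simp
        then show "of_int (coeff p i) * (of_int D * octo_power a (i + m) $ x) \<in> \<int>"
          by (rule Ints_mult[OF Ints_of_int])
      qed
      finally show ?thesis .
    qed
  qed
  \<comment> \<open>The norm is quadratic, so \<open>D\<close> is needed twice.\<close>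
  show ?thesis
  proof (rule rat_int_of_bounded_denominators)
    show "D * D \<noteq> 0" using D by simp
    fix n
    have "of_int (D * D) * octo_inner a a ^ n = (\<Sum>x\<in>UNIV.
        (of_int D * octo_power a n $ x) * (of_int D * octo_power a n $ x))"
      unfolding norm_power[symmetric] unfolding octo_inner_def by (simp add: sum_distrib_left ac_simps)
    also have "\<dots> \<in> \<int>" by (intro Ints_sum Ints_mult[OF bounded bounded])
    finally show "of_int (D * D) * octo_inner a a ^ n \<in> \<int>" .
  qed
qed

text \<open>Trace and norm are integers, and they are the coefficients of the quadratic equation.\<close>
lemma integral_half_OZ:
  fixes a :: "(rat, 'f) octo"
  assumes "a \<in> half_OZ" "4 dvd card (halving_set a)"
  shows "integral_octonion a"
proof -
  have "2 * a $ 0 \<in> \<int>" using assms(1) by (simp add: half_OZ_iff)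
  then obtain t :: int where t: "2 * a $ 0 = of_int t" by (auto elim: Ints_cases)
  have "octo_inner a a \<in> \<int>" using assms by (simp add: half_OZ_norm_iff)
  then obtain n :: int where n: "octo_inner a a = of_int n" by (auto elim: Ints_cases)
  let ?p = "[:n, - t, 1:] :: int poly"
  have "(\<Sum>i\<le>degree ?p. of_int (coeff ?p i) *s octo_power a i) = 0"
    using octo_square[of a] unfolding t n by (simp add: numeral_2_eq_2 algebra_simps vec_eq_iff)
  moreover have "lead_coeff ?p = 1" by simp
  ultimately show ?thesis unfolding integral_octonion_def by blast
qed

text \<open>A trace is a difference of norms: \<open>N (a + e\<^sup>x) = N a + 2 a\<^sub>x + 1\<close>.\<close>
lemma integral_order_half_OZ:
  fixes S :: "(rat, 'f) octo set"
  assumes "integral_order S" "a \<in> S"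
  shows "a \<in> half_OZ" and "4 dvd card (halving_set a)"
proof -
  have norm: "octo_inner b b \<in> \<int>" if "b \<in> S" for b
    using norm_integral that assms(1) by (auto simp: integral_order_def)
  have "2 * a $ x \<in> \<int>" for x
  proof -
    have "a + octo_e x \<in> S"
      using assms octo_e_OZ[of x] by (auto simp: integral_order_def octo_subring_def)
    then have "octo_inner (a + octo_e x) (a + octo_e x) - octo_inner a a - 1 \<in> \<int>"
      using norm assms(2) by (intro Ints_diff) auto
    then show ?thesis by (simp add: octo_inner_simps octo_e_nth)
  qed
  then show "a \<in> half_OZ" by (simp add: half_OZ_iff)
  then show "4 dvd card (halving_set a)"
    using norm assms(2) by (simp flip: half_OZ_norm_iff)
qed

end

section \<open>Orders described by codes of halving sets\<close>

definition code_order :: "'f::{field,finite} set set \<Rightarrow> (rat, 'f) octo set" where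
  "code_order C = {a \<in> half_OZ. halving_set a \<in> C}"

definition sym_diff_closed :: "'a set set \<Rightarrow> bool" where
  "sym_diff_closed C \<longleftrightarrow> (\<forall>X\<in>C. \<forall>Y\<in>C. sym_diff X Y \<in> C)"

definition additive_subgroup :: "'a::ab_group_add set \<Rightarrow> bool" where
  "additive_subgroup S \<longleftrightarrow> 0 \<in> S \<and> (\<forall>a\<in>S. \<forall>b\<in>S. a + b \<in> S) \<and> (\<forall>a\<in>S. - a \<in> S)"

lemma sym_diff_closedD: "sym_diff_closed C \<Longrightarrow> X \<in> C \<Longrightarrow> Y \<in> C \<Longrightarrow> sym_diff X Y \<in> C"
  by (simp add: sym_diff_closed_def)

lemma orbit_span_def': "orbit_span \<O> = sym_diff_closed hull \<O>"
  unfolding orbit_span_def sym_diff_closed_def ..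

lemma orbit_span_superset: "X \<in> \<O> \<Longrightarrow> X \<in> orbit_span \<O>"
  unfolding orbit_span_def' by (rule hull_inc)

lemma orbit_span_closed: "sym_diff_closed (orbit_span \<O>)"
  unfolding orbit_span_def' by (rule hull_in) (auto simp: sym_diff_closed_def)

lemma orbit_span_minimal: "\<O> \<subseteq> C \<Longrightarrow> sym_diff_closed C \<Longrightarrow> orbit_span \<O> \<subseteq> C"
  unfolding orbit_span_def' by (rule hull_minimal)

lemma empty_in_sym_diff_closed: "sym_diff_closed C \<Longrightarrow> C \<noteq> {} \<Longrightarrow> {} \<in> C"
  by (metis Diff_cancel Un_absorb ex_in_conv sym_diff_closedD)

lemma empty_in_orbit_span: "\<O> \<noteq> {} \<Longrightarrow> {} \<in> orbit_span \<O>"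
  by (metis empty_in_sym_diff_closed ex_in_conv orbit_span_closed orbit_span_superset)

lemma additive_subgroup_simps:
  assumes "additive_subgroup S"
  shows "0 \<in> S" "a \<in> S \<Longrightarrow> b \<in> S \<Longrightarrow> a + b \<in> S" "a \<in> S \<Longrightarrow> - a \<in> S"
    "a \<in> S \<Longrightarrow> b \<in> S \<Longrightarrow> a - b \<in> S"
  using assms by (auto simp: additive_subgroup_def) (metis diff_conv_add_uminus)

lemma additive_subgroup_sum:
  assumes "additive_subgroup S" "\<And>i. i \<in> A \<Longrightarrow> f i \<in> S"
  shows "sum f A \<in> S"
  using assms(2) by (induction A rule: infinite_finite_induct) (auto simp: additive_subgroup_simps[OF assms(1)])

lemma additive_subgroup_scale:
  fixes S :: "(rat, 'f::{field,finite}) octo set"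
  assumes "additive_subgroup S" "a \<in> S" "k \<in> \<int>"
  shows "k *s a \<in> S"
proof -
  have nat: "of_nat n *s a \<in> S" for n
  proof (induction n)
    case (Suc n)
    have "of_nat (Suc n) *s a = a + of_nat n *s a" by (simp add: vec_eq_iff algebra_simps)
    then show ?case using additive_subgroup_simps(2)[OF assms(1,2) Suc] by simp
  qed (simp add: additive_subgroup_simps[OF assms(1)])
  obtain i where "k = of_int i" using assms(3) by (auto elim: Ints_cases)
  then have "k *s a = of_nat (nat i) *s a - of_nat (nat (- i)) *s a"
    by (cases "i \<ge> 0") (auto simp: vec_eq_iff)
  then show ?thesis using nat additive_subgroup_simps(4)[OF assms(1)] by metis
qed

lemma int_span_superset: "G \<subseteq> int_span G"
  unfolding int_span_def by (rule module.span_superset[OF module_int_scale])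

lemma int_span_additive: "additive_subgroup (int_span G)"
  unfolding int_span_def additive_subgroup_def
  by (auto intro: module.span_zero[OF module_int_scale] module.span_add[OF module_int_scale]
      module.span_neg[OF module_int_scale])

lemma int_span_minimal:
  assumes "G \<subseteq> S" "additive_subgroup S"
  shows "int_span G \<subseteq> S"
  unfolding int_span_def
proof (rule module.span_minimal[OF module_int_scale assms(1)])
  show "module.subspace (\<lambda>(k::int) v. of_int k *s v) S"
    unfolding module.subspace_def[OF module_int_scale]
    using assms(2) by (auto simp: additive_subgroup_simps additive_subgroup_scale)
qed

lemma OZ_subset_additive:
  fixes S :: "(rat, 'f::{field,finite}) octo set"
  assumes "additive_subgroup S" "range octo_e \<subseteq> S"
  shows "OZ \<subseteq> S"
proof
  fix a :: "(rat, 'f) octo"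
  assume "a \<in> OZ"
  then have "(\<Sum>x\<in>UNIV. (a $ x) *s octo_e x) \<in> S"
    using assms by (intro additive_subgroup_sum additive_subgroup_scale) (auto simp: OZ_iff)
  then show "a \<in> S" by (simp flip: octo_expansion)
qed

lemma code_order_additive:
  assumes "sym_diff_closed C" "{} \<in> C"
  shows "additive_subgroup (code_order C)"
  using assms unfolding additive_subgroup_def code_order_def
  by (auto simp: half_OZ_add half_OZ_minus halving_set_minus halving_set_add sym_diff_closed_def)
    (auto simp: half_OZ_iff halving_set_def)

lemma OZ_subset_code_order: "{} \<in> C \<Longrightarrow> OZ \<subseteq> code_order C"
  unfolding code_order_def
  by (auto simp: OZ_subset_half_OZ) (metis halving_set_empty_iff)

lemma half_e_set_code_order: "half_e_set X \<in> code_order C \<longleftrightarrow> X \<in> C"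
  by (simp add: code_order_def half_e_set_half_OZ)

lemma half_e_set_sym_diff:
  "half_e_set (sym_diff X Y) = half_e_set X + half_e_set Y - (\<Sum>x\<in>X \<inter> Y. octo_e x)"
  by (auto simp: vec_eq_iff half_e_set_nth sum_component octo_e_nth)

text \<open>Modulo integral octonions, addition is the symmetric difference of halving sets.\<close>
lemma orbit_order_eq_code_order:
  fixes \<O> :: "'f::{field,finite} set set"
  assumes "\<O> \<noteq> {}"
  shows "orbit_order \<O> = code_order (orbit_span \<O>)"
proof
  let ?G = "range octo_e \<union> half_e_set ` \<O>"
  let ?C = "orbit_span \<O>"
  have E: "additive_subgroup (int_span ?G)" by (rule int_span_additive)
  have OZ: "OZ \<subseteq> int_span ?G"
    using int_span_superset[of ?G] by (intro OZ_subset_additive E) auto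
  show "orbit_order \<O> \<subseteq> code_order ?C"
    unfolding orbit_order_def
  proof (rule int_span_minimal)
    show "?G \<subseteq> code_order ?C"
      using OZ_subset_code_order[OF empty_in_orbit_span[OF assms]] octo_e_OZ
      by (auto simp: half_e_set_code_order orbit_span_superset)
  qed (intro code_order_additive orbit_span_closed empty_in_orbit_span assms)
  have "?C \<subseteq> {X. half_e_set X \<in> int_span ?G}"
  proof (rule orbit_span_minimal)
    show "\<O> \<subseteq> {X. half_e_set X \<in> int_span ?G}" using int_span_superset[of ?G] by auto
    have "(\<Sum>x\<in>A. octo_e x) \<in> int_span ?G" for A
      using int_span_superset[of ?G] by (intro additive_subgroup_sum E) auto
    then show "sym_diff_closed {X. half_e_set X \<in> int_span ?G}"
      unfolding sym_diff_closed_def mem_Collect_eq half_e_set_sym_diff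
      by (intro ballI additive_subgroup_simps[OF E]) simp_all
  qed
  then have half: "half_e_set X \<in> int_span ?G" if "X \<in> ?C" for X using that by blast
  show "code_order ?C \<subseteq> orbit_order \<O>"
  proof
    fix a assume a: "a \<in> code_order ?C"
    let ?h = "half_e_set (halving_set a)"
    have "a - ?h \<in> OZ"
      using a by (intro diff_OZ_if_halving_set_eq half_e_set_half_OZ) (simp_all add: code_order_def)
    then have "?h + (a - ?h) \<in> int_span ?G"
      using a OZ half by (intro additive_subgroup_simps(2)[OF E]) (auto simp: code_order_def)
    then show "a \<in> orbit_order \<O>" by (simp add: orbit_order_def)
  qed
qed

lemma card_sym_diff:
  assumes "finite X" "finite Y"
  shows "card (sym_diff X Y) + 2 * card (X \<inter> Y) = card X + card Y"
proof -
  have "card (sym_diff X Y) = card (X - Y) + card (Y - X)"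
    using assms by (intro card_Un_disjoint) auto
  moreover have "card X = card (X - Y) + card (X \<inter> Y)" "card Y = card (Y - X) + card (X \<inter> Y)"
    using assms by (metis add.commute card_Diff_subset_Int card_mono finite_Int inf_le1 le_add_diff_inverse)
      (metis assms(2) add.commute card_Diff_subset_Int card_mono finite_Int inf_le1 inf_commute le_add_diff_inverse)
  ultimately show ?thesis by simp
qed

lemma even_card_sym_diff:
  assumes "finite X" "finite Y"
  shows "even (card (sym_diff X Y)) \<longleftrightarrow> (even (card X) \<longleftrightarrow> even (card Y))"
  using card_sym_diff[OF assms] by presburger

context field_eight
begin

lemma mem_translate: "w \<in> (+) (z::'f) ` X \<longleftrightarrow> z + w \<in> X"
  by (metis (no_types, lifting) add_self_left image_iff)

lemma translate_sym_diff: "(+) (z::'f) ` sym_diff X Y = sym_diff ((+) z ` X) ((+) z ` Y)"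
  by (auto simp: mem_translate)

lemma translate_translate: "(+) (z::'f) ` (+) w ` X = (+) (z + w) ` X"
  by (auto simp: mem_translate ac_simps)

lemma card_translate [simp]: "card ((+) (z::'f) ` X) = card X"
  by (simp add: card_image)

lemma translation_orbit_iff: "Y \<in> translation_orbit X \<longleftrightarrow> (\<exists>z::'f. Y = (+) z ` X)"
  by (auto simp: translation_orbit_def)

lemma translate_in_translation_orbit: "(+) z ` X \<in> translation_orbit (X :: 'f set)"
  unfolding translation_orbit_iff by (rule exI) (rule refl)

lemma translation_orbit_self: "X \<in> translation_orbit (X :: 'f set)"
  using translate_in_translation_orbit[of 0 X] by simp

lemma translation_orbit_translate: "Y \<in> translation_orbit X \<Longrightarrow> (+) (z::'f) ` Y \<in> translation_orbit X"
  unfolding translation_orbit_iff by (metis translate_translate)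

lemma translation_orbit_eq:
  assumes "Y \<in> translation_orbit (X :: 'f set)"
  shows "translation_orbit Y = translation_orbit X"
proof -
  have sub: "translation_orbit Z \<subseteq> translation_orbit W" if "Z \<in> translation_orbit W" for Z W :: "'f set"
    using translation_orbit_translate[OF that] by (auto simp only: translation_orbit_iff[of _ Z])
  obtain z where "Y = (+) z ` X" using assms by (auto simp: translation_orbit_iff)
  then have "X = (+) z ` Y" by (simp add: translate_translate)
  then show ?thesis using sub[of X Y] sub[OF assms] by (auto simp only: translation_orbit_iff)
qed

lemma orbit_span_translate:
  assumes "Y \<in> orbit_span (translation_orbit (X :: 'f set))"
  shows "(+) z ` Y \<in> orbit_span (translation_orbit X)"
proof -
  have "orbit_span (translation_orbit X) \<subseteq> {Y. (+) z ` Y \<in> orbit_span (translation_orbit X)}"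
  proof (rule orbit_span_minimal)
    show "translation_orbit X \<subseteq> {Y. (+) z ` Y \<in> orbit_span (translation_orbit X)}"
      by (simp add: subset_iff translation_orbit_translate orbit_span_superset)
    show "sym_diff_closed {Y. (+) z ` Y \<in> orbit_span (translation_orbit X)}"
      unfolding sym_diff_closed_def mem_Collect_eq translate_sym_diff
      by (intro ballI sym_diff_closedD[OF orbit_span_closed]) simp_all
  qed
  then show ?thesis using assms by blast
qed

lemma octo_e_mult_nth: "(octo_e (z::'f) \<odot> a) $ w = a $ (z + w) * octo_sign z (z + w)"
  by (simp add: octo_mult_nth octo_e_nth if_distrib[of "\<lambda>u. u * _"] add.commute cong: if_cong)

lemma octo_mult_e_nth: "(a \<odot> octo_e (z::'f)) $ w = a $ (z + w) * octo_sign (z + w) z"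
proof -
  have "a $ x * octo_e z $ (w - x) * octo_sign x (w - x)
      = (if x = z + w then a $ x * octo_sign x z else 0)" for x
  proof -
    have "z = w - x \<longleftrightarrow> x = z + w" by (metis add.commute add_eq_iff diff_eq_add)
    then show ?thesis by (auto simp: octo_e_nth)
  qed
  then show ?thesis by (simp add: octo_mult_nth del: diff_eq_add)
qed

lemma halving_set_e_mult: "halving_set (octo_e (z::'f) \<odot> a) = (+) z ` halving_set a"
  and halving_set_mult_e: "halving_set (a \<odot> octo_e z) = (+) z ` halving_set a"
  by (auto simp: halving_set_iff octo_e_mult_nth octo_mult_e_nth mem_translate octo_sign_def split: if_splits)

lemma half_OZ_e_mult: "a \<in> half_OZ \<Longrightarrow> octo_e (z::'f) \<odot> a \<in> half_OZ"
  and half_OZ_mult_e: "a \<in> half_OZ \<Longrightarrow> a \<odot> octo_e z \<in> half_OZ"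
  by (auto simp: half_OZ_iff octo_e_mult_nth octo_mult_e_nth octo_sign_def)

lemma OZ_mult: "a \<in> OZ \<Longrightarrow> b \<in> OZ \<Longrightarrow> a \<odot> b \<in> OZ"
  for a b :: "(rat, 'f) octo"
  unfolding OZ_iff octo_mult_nth
  by (auto intro!: Ints_sum Ints_mult simp: octo_sign_def)

lemma octo_mult_left_expansion: "a \<odot> b = (\<Sum>x\<in>UNIV. (a $ x) *s (octo_e (x::'f) \<odot> b))"
  by (subst octo_expansion[of a]) (simp add: octo_mult_sum_left octo_mult_scale_left)

lemma octo_mult_right_expansion: "a \<odot> b = (\<Sum>x\<in>UNIV. (b $ x) *s (a \<odot> octo_e (x::'f)))"
  by (subst octo_expansion[of b]) (simp add: octo_mult_sum_right octo_mult_scale_right)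

lemma Hsets_iff: "X \<in> Hsets \<longleftrightarrow> 4 dvd card (X :: 'f set)"
proof -
  have "card X \<le> 8" using card_mono[of UNIV X] by (simp add: card_field)
  then have "4 dvd card X \<longleftrightarrow> card X = 0 \<or> card X = 4 \<or> card X = 8" by presburger
  then show ?thesis by (simp add: Hsets_def)
qed

lemma Hsets_cases:
  assumes "X \<in> (Hsets :: 'f set set)"
  shows "X = {} \<or> X = UNIV \<or> card X = 4"
  using assms card_field card_subset_eq[of UNIV X] by (auto simp: Hsets_def)

lemma norm_half_e_set:
  assumes "X \<in> Hsets"
  shows "octo_inner (half_e_set X) (half_e_set (X :: 'f set)) \<in> \<int>"
  using assms by (simp add: half_OZ_norm_iff half_e_set_half_OZ Hsets_iff)

text \<open>Every generator \<open>e\<^sup>Y / 2\<close> with \<open>Y = u + X\<close> is congruent, modulo integral octonions, both to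
  \<open>h e\<^sup>u\<close> and to \<open>e\<^sup>u h\<close>, where \<open>h = e\<^sup>X / 2\<close>. By the Moufang identity the products
  \<open>(h e\<^sup>u) (e\<^sup>w h)\<close> are integral combinations of \<open>h\<close> and the basis.\<close>
lemma code_order_mult:
  fixes X :: "'f set"
  assumes X: "X \<in> Hsets"
  defines "E \<equiv> code_order (orbit_span (translation_orbit X))"
  assumes a: "a \<in> E" and b: "b \<in> E"
  shows "a \<odot> b \<in> E"
proof -
  let ?O = "translation_orbit X"
  let ?h = "half_e_set X"
  let ?G = "range octo_e \<union> half_e_set ` ?O"
  have ne: "?O \<noteq> {}" using translation_orbit_self by blast
  have add: "additive_subgroup E"
    unfolding E_def by (intro code_order_additive orbit_span_closed empty_in_orbit_span ne)
  have OZ: "OZ \<subseteq> E" unfolding E_def by (intro OZ_subset_code_order empty_in_orbit_span ne)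
  have span: "E = int_span ?G"
    unfolding E_def by (simp add: orbit_order_eq_code_order[OF ne, symmetric] orbit_order_def)
  have e_mult: "octo_e z \<odot> b \<in> E" and mult_e: "b \<odot> octo_e z \<in> E" if "b \<in> E" for b z
    using that by (simp_all add: E_def code_order_def half_OZ_e_mult half_OZ_mult_e
        halving_set_e_mult halving_set_mult_e orbit_span_translate)
  have int_mult: "i \<odot> b \<in> E" and mult_int: "b \<odot> i \<in> E" if "i \<in> OZ" "b \<in> E" for i b
  proof -
    show "i \<odot> b \<in> E"
      using that by (subst octo_mult_left_expansion)
        (auto intro!: additive_subgroup_sum[OF add] additive_subgroup_scale[OF add] simp: OZ_iff e_mult)
    show "b \<odot> i \<in> E"
      using that by (subst octo_mult_right_expansion)
        (auto intro!: additive_subgroup_sum[OF add] additive_subgroup_scale[OF add] simp: OZ_iff mult_e)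
  qed
  have h: "?h \<in> E"
    by (simp add: E_def half_e_set_code_order orbit_span_superset translation_orbit_self)
  have gen: "half_e_set ((+) u ` X) \<odot> half_e_set ((+) w ` X) \<in> E" for u w
  proof -
    let ?a = "half_e_set ((+) u ` X)" and ?b = "half_e_set ((+) w ` X)"
    define i j where "i = ?a - ?h \<odot> octo_e u" and "j = ?b - octo_e w \<odot> ?h"
    have i: "i \<in> OZ" unfolding i_def
      by (intro diff_OZ_if_halving_set_eq half_OZ_mult_e half_e_set_half_OZ)
        (simp add: halving_set_mult_e)
    have j: "j \<in> OZ" unfolding j_def
      by (intro diff_OZ_if_halving_set_eq half_OZ_e_mult half_e_set_half_OZ)
        (simp add: halving_set_e_mult)
    have b: "?b \<in> E"
      unfolding E_def half_e_set_code_order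
      by (intro orbit_span_superset translate_in_translation_orbit)
    have conj: "octo_conj (octo_e z) \<in> OZ" for z :: 'f
      by (simp add: octo_conj_def OZ_iff octo_e_nth)
    have "2 * octo_inner (?h \<odot> octo_e u) (octo_conj (octo_e w))
        = (\<Sum>x\<in>UNIV. 2 * (?h \<odot> octo_e u) $ x * octo_conj (octo_e w) $ x)"
      by (simp add: octo_inner_def sum_distrib_left mult.assoc)
    also have "\<dots> \<in> \<int>"
      using half_OZ_mult_e[OF half_e_set_half_OZ, of X u] conj[of w]
      by (intro Ints_sum Ints_mult[of "2 * _"]) (simp_all add: half_OZ_iff OZ_iff)
    finally have "(?h \<odot> octo_e u) \<odot> (octo_e w \<odot> ?h) \<in> E"
      unfolding moufang using norm_half_e_set[OF X] OZ OZ_mult[OF conj conj] h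
      by (intro additive_subgroup_simps(4)[OF add] additive_subgroup_scale[OF add]) auto
    moreover have "?a \<odot> ?b = (?h \<odot> octo_e u) \<odot> (octo_e w \<odot> ?h) + (?h \<odot> octo_e u) \<odot> j + i \<odot> ?b"
      by (simp add: i_def j_def octo_mult_diff_left octo_mult_diff_right)
    ultimately show ?thesis
      using i j b by (simp add: additive_subgroup_simps(2)[OF add] int_mult mult_int mult_e h)
  qed
  have "int_span ?G \<subseteq> {a. \<forall>b\<in>E. a \<odot> b \<in> E}"
  proof (rule int_span_minimal)
    have "E \<subseteq> {b. half_e_set Y \<odot> b \<in> E}" if Y: "Y \<in> ?O" for Y
      unfolding span
    proof (rule int_span_minimal, fold span)
      have "half_e_set Y \<in> E"
        using Y by (simp add: E_def half_e_set_code_order orbit_span_superset)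
      then show "?G \<subseteq> {b. half_e_set Y \<odot> b \<in> E}"
        using gen Y by (auto simp: mult_e translation_orbit_iff)
      show "additive_subgroup {b. half_e_set Y \<odot> b \<in> E}"
        using additive_subgroup_simps[OF add]
        by (auto simp: additive_subgroup_def octo_mult_zero_right octo_mult_add_right)
          (metis diff_0 octo_mult_diff_right octo_mult_zero_right)
    qed
    then show "?G \<subseteq> {a. \<forall>b\<in>E. a \<odot> b \<in> E}" by (auto simp: e_mult)
    show "additive_subgroup {a. \<forall>b\<in>E. a \<odot> b \<in> E}"
      using additive_subgroup_simps[OF add]
      by (auto simp: additive_subgroup_def octo_mult_zero_left octo_mult_add_left)
        (metis diff_0 octo_mult_diff_left octo_mult_zero_left)
  qed
  then show ?thesis using a b span by blast
qed

lemma even_card_if_translation_invariant: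
  assumes "finite (A :: 'f set)" "z \<noteq> 0" "\<And>x. x \<in> A \<Longrightarrow> z + x \<in> A"
  shows "even (card A)"
  using assms
proof (induction A rule: finite_psubset_induct)
  case (psubset A)
  show ?case
  proof (cases "A = {}")
    case False
    then obtain x where x: "x \<in> A" by blast
    let ?P = "{x, z + x}"
    have P: "?P \<subseteq> A" "card ?P = 2" using x psubset.prems by auto
    have "even (card (A - ?P))"
    proof (rule psubset.IH)
      show "A - ?P \<subset> A" using x by blast
      show "z + y \<in> A - ?P" if "y \<in> A - ?P" for y
        using that psubset.prems by (auto simp: add_eq_iff)
    qed (fact psubset.prems)
    then show ?thesis using P psubset.hyps card_mono[OF psubset.hyps(1) P(1)]
      by (simp add: card_Diff_subset)
  qed simp
qed

text \<open>Translation by \<open>z \<noteq> 0\<close> is an involution of \<open>X \<inter> (z + X)\<close> without fixed points.\<close>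
lemma even_card_translation_orbit_Int:
  assumes "X \<in> Hsets" "Y \<in> translation_orbit X" "Z \<in> translation_orbit (X :: 'f set)"
  shows "even (card (Y \<inter> Z))"
proof -
  obtain u w where Y: "Y = (+) u ` X" and Z: "Z = (+) w ` X"
    using assms by (auto simp: translation_orbit_iff)
  show ?thesis
  proof (cases "u = w")
    case True
    have "even (card X)" using assms(1) by (auto simp: Hsets_def)
    then show ?thesis using Y Z True by simp
  next
    case False
    have "u + w + x \<in> Y \<inter> Z" if "x \<in> Y \<inter> Z" for x
    proof -
      have "u + (u + w + x) = w + x" "w + (u + w + x) = u + x" by (simp_all add: ac_simps)
      then show ?thesis using that unfolding Y Z Int_iff mem_translate by simp
    qed
    then show ?thesis
      using False by (intro even_card_if_translation_invariant[of "Y \<inter> Z" "u + w"]) simp_all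
  qed
qed

text \<open>The span of a set of vectors that are pairwise orthogonal, and orthogonal to themselves,
  is self-orthogonal; then the condition that \<open>4\<close> divides the size is stable under sums.\<close>
lemma orbit_span_doubly_even:
  assumes X: "X \<in> Hsets" and Y: "Y \<in> orbit_span (translation_orbit (X :: 'f set))"
  shows "4 dvd card Y"
proof -
  let ?O = "translation_orbit X"
  have closed: "sym_diff_closed {Y :: 'f set. \<forall>Z\<in>B. even (card (Z \<inter> Y))}" for B
  proof -
    have "Z \<inter> sym_diff Y Y' = sym_diff (Z \<inter> Y) (Z \<inter> Y')" for Z Y Y' :: "'f set" by blast
    then show ?thesis by (simp add: sym_diff_closed_def even_card_sym_diff)
  qed
  have "orbit_span ?O \<subseteq> {Y. \<forall>Z\<in>?O. even (card (Z \<inter> Y))}"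
    using even_card_translation_orbit_Int[OF X] by (intro orbit_span_minimal closed) auto
  then have "even (card (Y \<inter> Z))" if "Y \<in> ?O" "Z \<in> orbit_span ?O" for Y Z
    using that by blast
  then have "?O \<subseteq> {Y. \<forall>Z\<in>orbit_span ?O. even (card (Z \<inter> Y))}"
    unfolding subset_iff mem_Collect_eq by (subst Int_commute) blast
  then have "orbit_span ?O \<subseteq> {Y. \<forall>Z\<in>orbit_span ?O. even (card (Z \<inter> Y))}"
    by (intro orbit_span_minimal closed)
  then have orth: "even (card (Y \<inter> Z))" if "Y \<in> orbit_span ?O" "Z \<in> orbit_span ?O" for Y Z
    using that by blast
  have "orbit_span ?O \<subseteq> {Y \<in> orbit_span ?O. 4 dvd card Y}"
  proof (rule orbit_span_minimal)
    show "?O \<subseteq> {Y \<in> orbit_span ?O. 4 dvd card Y}"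
      using X by (auto simp: orbit_span_superset translation_orbit_iff Hsets_iff)
    have "4 dvd card (sym_diff Y Z)"
      if "Y \<in> orbit_span ?O" "Z \<in> orbit_span ?O" "4 dvd card Y" "4 dvd card Z" for Y Z
      using card_sym_diff[of Y Z] orth[OF that(1,2)] that(3,4) by simp presburger
    then show "sym_diff_closed {Y \<in> orbit_span ?O. 4 dvd card Y}"
      using sym_diff_closedD[OF orbit_span_closed] unfolding sym_diff_closed_def by blast
  qed
  then show ?thesis using Y by blast
qed

lemma octo_subring_additive: "octo_subring S \<Longrightarrow> additive_subgroup S"
  by (simp add: octo_subring_def additive_subgroup_def)

lemma integral_order_orbit_span:
  assumes X: "X \<in> (Hsets :: 'f set set)"
  shows "integral_order (code_order (orbit_span (translation_orbit X)))"
proof -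
  let ?C = "orbit_span (translation_orbit X)"
  have E: "{} \<in> ?C" using translation_orbit_self by (intro empty_in_orbit_span) blast
  have "octo_subring (code_order ?C)"
    using code_order_additive[OF orbit_span_closed E] code_order_mult[OF X]
    by (simp add: octo_subring_def additive_subgroup_def)
  then show ?thesis
    using OZ_subset_code_order[OF E] orbit_span_doubly_even[OF X]
    by (auto simp: integral_order_def code_order_def intro: integral_half_OZ)
qed

text \<open>The translates of \<open>X\<close> are the halving sets of the products \<open>e\<^sup>z (e\<^sup>X / 2)\<close>, so the subalgebra
  contains all generators of the orbit order.\<close>
lemma generated_subalgebra_eq:
  assumes X: "X \<in> (Hsets :: 'f set set)"
  shows "generated_subalgebra (OZ \<union> {half_e_set X}) = orbit_order (translation_orbit X)"
proof
  let ?O = "translation_orbit X" and ?T = "generated_subalgebra (OZ \<union> {half_e_set X})"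
  have ne: "?O \<noteq> {}" using translation_orbit_self by blast
  have order: "integral_order (orbit_order ?O)"
    unfolding orbit_order_eq_code_order[OF ne] by (rule integral_order_orbit_span[OF X])
  have "half_e_set X \<in> orbit_order ?O"
    unfolding orbit_order_eq_code_order[OF ne]
    by (simp add: half_e_set_code_order orbit_span_superset translation_orbit_self)
  then show "?T \<subseteq> orbit_order ?O"
    using order unfolding generated_subalgebra_def by (intro hull_minimal) (auto simp: integral_order_def)
  have T: "octo_subring ?T"
    unfolding generated_subalgebra_def by (rule hull_in) (auto simp: octo_subring_def)
  have sub: "OZ \<union> {half_e_set X} \<subseteq> ?T" unfolding generated_subalgebra_def by (rule hull_subset)
  have "half_e_set ((+) z ` X) \<in> ?T" for z
  proof -
    have "half_e_set ((+) z ` X) - octo_e z \<odot> half_e_set X \<in> OZ"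
      by (intro diff_OZ_if_halving_set_eq half_OZ_e_mult half_e_set_half_OZ)
        (simp add: halving_set_e_mult)
    then have "half_e_set ((+) z ` X) - octo_e z \<odot> half_e_set X + octo_e z \<odot> half_e_set X \<in> ?T"
      using sub octo_e_OZ[of z] T unfolding octo_subring_def by blast
    then show ?thesis by simp
  qed
  then show "orbit_order ?O \<subseteq> ?T"
    unfolding orbit_order_def using sub octo_e_OZ
    by (intro int_span_minimal octo_subring_additive T) (auto simp: translation_orbit_iff)
qed

section \<open>The code of an order\<close>

text \<open>Translations come from the products with \<open>e\<^sup>z\<close>, and the even intersections from
  \<open>\<bar>X\<bar> + \<bar>Y\<bar> - 2 \<bar>X \<inter> Y\<bar>\<close> being the size of the symmetric difference.\<close>
lemma integral_order_code:
  fixes S :: "(rat, 'f) octo set"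
  assumes S: "integral_order S"
  defines "C \<equiv> halving_set ` S"
  shows "S = code_order C" "sym_diff_closed C" "{} \<in> C" "\<And>X z. X \<in> C \<Longrightarrow> (+) z ` X \<in> C"
    "\<And>X. X \<in> C \<Longrightarrow> X \<in> Hsets" "\<And>X Y. X \<in> C \<Longrightarrow> Y \<in> C \<Longrightarrow> even (card (X \<inter> Y))"
proof -
  have ring: "octo_subring S" and OZ: "OZ \<subseteq> S" using S by (auto simp: integral_order_def)
  note half = integral_order_half_OZ[OF S]
  show "S = code_order C"
  proof
    show "S \<subseteq> code_order C" using half by (auto simp: code_order_def C_def)
    show "code_order C \<subseteq> S"
    proof
      fix a assume "a \<in> code_order C"
      then obtain s where s: "s \<in> S" "halving_set a = halving_set s" "a \<in> half_OZ"
        by (auto simp: code_order_def C_def)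
      then have "a - s \<in> S" using diff_OZ_if_halving_set_eq[of a s] half OZ by blast
      then have "a - s + s \<in> S" using s ring unfolding octo_subring_def by blast
      then show "a \<in> S" by simp
    qed
  qed
  show closed: "sym_diff_closed C"
    unfolding sym_diff_closed_def C_def
    using ring half by (auto simp flip: halving_set_add simp: octo_subring_def)
  show "{} \<in> C"
    using OZ halving_set_empty_iff[of 0] by (force simp: C_def OZ_iff)
  show "(+) z ` X \<in> C" if X: "X \<in> C" for X z
  proof -
    obtain s where s: "s \<in> S" "X = halving_set s" using X by (auto simp: C_def)
    then have "octo_e z \<odot> s \<in> S" using ring OZ octo_e_OZ[of z] by (auto simp: octo_subring_def)
    then show ?thesis using s by (auto simp: C_def simp flip: halving_set_e_mult)
  qed
  show H: "X \<in> Hsets" if "X \<in> C" for X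
    using that half by (auto simp: C_def Hsets_iff)
  show "even (card (X \<inter> Y))" if "X \<in> C" "Y \<in> C" for X Y
    using card_sym_diff[of X Y] H[OF that(1)] H[OF that(2)] H[OF sym_diff_closedD[OF closed that]]
    unfolding Hsets_iff by simp presburger
qed

end

section \<open>Four-element sets and their sums\<close>

lemma sum_comb_in_sym_diff_closed:
  assumes "sym_diff_closed C" "{} \<in> C" "finite Z" "\<And>z. z \<in> Z \<Longrightarrow> g z \<in> C"
  shows "{w. odd (card {z \<in> Z. w \<in> g z})} \<in> C"
  using assms(3,4)
proof (induction Z rule: finite_induct)
  case (insert x F)
  have "{z \<in> insert x F. w \<in> g z} = (if w \<in> g x then insert x {z \<in> F. w \<in> g z} else {z \<in> F. w \<in> g z})" for w
    by auto
  then have "{w. odd (card {z \<in> insert x F. w \<in> g z})} = sym_diff (g x) {w. odd (card {z \<in> F. w \<in> g z})}"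
    using insert.hyps by auto
  then show ?case using insert sym_diff_closedD[OF assms(1)] by simp
qed (use assms(2) in simp)

lemma card_4_otherE:
  assumes "card X = 4"
  obtains y where "y \<in> X" "y \<noteq> x"
proof -
  have "\<not> X \<subseteq> {x}" using card_mono[of "{x}" X] assms by auto
  then show thesis using that by blast
qed

lemma card_4_pairE:
  assumes "card X = 4" "p \<in> X" "q \<in> X" "p \<noteq> q"
  obtains r s where "X = {p, q, r, s}" "r \<notin> {p, q}" "s \<notin> {p, q, r}"
proof -
  have "finite X" using assms(1) card.infinite by force
  then have "card (X - {p, q}) = 2" using assms by (simp add: card_Diff_subset)
  then obtain r s where "X - {p, q} = {r, s}" "r \<noteq> s" by (auto simp: card_2_iff)
  then show thesis using assms(2,3) by (intro that[of r s]) auto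
qed

context field_eight
begin

lemma ex_not_in: "card A < 8 \<Longrightarrow> \<exists>z. z \<notin> (A :: 'f set)"
  using card_field by (metis UNIV_eq_I less_irrefl)

lemma sum_translate:
  assumes "4 dvd card X"
  shows "\<Sum>((+) (z::'f) ` X) = \<Sum>X"
proof -
  obtain k where k: "card X = 4 * k" using assms by (rule dvdE)
  have "of_nat (card X) = (of_nat 2 * of_nat (2 * k) :: 'f)"
    unfolding k of_nat_mult[symmetric] by simp
  then have "of_nat (card X) = (0 :: 'f)" by simp
  then show ?thesis by (simp add: sum.reindex sum.distrib)
qed

lemma sum_sym_diff: "\<Sum>(sym_diff X Y) = \<Sum>X + \<Sum>(Y :: 'f set)"
proof -
  have "\<Sum>(sym_diff X Y) = \<Sum>(X - Y) + \<Sum>(Y - X)" by (intro sum.union_disjoint) auto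
  moreover have "\<Sum>X = \<Sum>(X \<inter> Y) + \<Sum>(X - Y)" "\<Sum>Y = \<Sum>(X \<inter> Y) + \<Sum>(Y - X)"
    using sum.Int_Diff[of X "\<lambda>x. x" Y] sum.Int_Diff[of Y "\<lambda>x. x" X] by (simp_all add: Int_commute)
  ultimately show ?thesis by (simp add: ac_simps)
qed

lemma sum_UNIV: "\<Sum>(UNIV :: 'f set) = 0"
proof -
  obtain z :: 'f where z: "z \<notin> {0, 1}" using ex_not_in[of "{0, 1}"] by auto
  have "\<Sum>(UNIV :: 'f set) = (\<Sum>y\<in>UNIV. z * y)"
    by (rule sum.reindex_bij_witness[of _ "\<lambda>y. z * y" "\<lambda>y. y / z"]) (use z in auto)
  then have "\<Sum>(UNIV :: 'f set) = z * \<Sum>(UNIV :: 'f set)"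
    using sum_distrib_left[of z "\<lambda>y. y" UNIV] by (rule trans[OF _ sym])
  then have "(z + 1) * \<Sum>(UNIV :: 'f set) = 0" by (simp only: distrib_right mult_1 add_self)
  then show ?thesis using z by simp
qed

lemma card_4_if_sum_nonzero: "X \<in> Hsets \<Longrightarrow> \<Sum>X \<noteq> 0 \<Longrightarrow> card (X :: 'f set) = 4"
  using Hsets_cases[of X] sum_UNIV by auto

lemma translation_orbit_card: "Y \<in> translation_orbit X \<Longrightarrow> card Y = card (X :: 'f set)"
  by (auto simp: translation_orbit_iff)

lemma translation_orbit_sum: "X \<in> Hsets \<Longrightarrow> Y \<in> translation_orbit X \<Longrightarrow> \<Sum>Y = \<Sum>(X :: 'f set)"
  by (auto simp: translation_orbit_iff sum_translate Hsets_iff)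

lemma orbit_span_sum:
  assumes "X \<in> Hsets" "Y \<in> orbit_span (translation_orbit (X :: 'f set))"
  shows "\<Sum>Y \<in> {0, \<Sum>X}"
proof -
  have "orbit_span (translation_orbit X) \<subseteq> {Y. \<Sum>Y \<in> {0, \<Sum>X}}"
    by (rule orbit_span_minimal)
      (use assms(1) in \<open>auto simp: sym_diff_closed_def sum_sym_diff translation_orbit_sum\<close>)
  then show ?thesis using assms(2) by blast
qed

lemma subgroup_4_add:
  "u \<in> {0, p, q, p + q} \<Longrightarrow> v \<in> {0, p, q, p + q} \<Longrightarrow> u + v \<in> {0, p, q, p + (q::'f)}"
  by (auto simp: ac_simps)

text \<open>A four-element set of sum \<open>0\<close> is a coset of a subgroup, for which one generator may be chosen
  freely among the differences.\<close>
lemma zero_sum_form: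
  assumes X: "card X = 4" "\<Sum>X = 0" and u: "u \<in> X" and p: "u + p \<in> X" "p \<noteq> (0 :: 'f)"
  obtains q where "q \<notin> {0, p}" "X = (+) u ` {0, p, q, p + q}"
proof -
  obtain r s where rs: "X = {u, u + p, r, s}" "r \<notin> {u, u + p}" "s \<notin> {u, u + p, r}"
    using card_4_pairE[OF X(1) u p(1)] p(2) by (metis add_0_right add_left_cancel)
  then have "u + (u + p + (r + s)) = 0" using X(2) p(2) by auto
  then have s: "s = r + p" by (simp add: ac_simps)
  show thesis
    using rs by (intro that[of "u + r"]) (auto simp: s ac_simps add_eq_iff)
qed

lemma zero_sum_translate:
  assumes X: "card X = 4" "\<Sum>X = (0 :: 'f)"
  shows "(+) z ` X \<in> {X, - X}"
proof -
  obtain u v where uv: "u \<in> X" "v \<in> X" "u \<noteq> v"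
    using X(1) by (metis card_4_otherE)
  then obtain q where q: "q \<notin> {0, u + v}" and Xq: "X = (+) u ` {0, u + v, q, u + v + q}"
    using zero_sum_form[OF X uv(1), of "u + v"] by auto
  let ?D = "{0, u + v, q, u + v + q}"
  have XD: "x \<in> X \<longleftrightarrow> u + x \<in> ?D" for x unfolding Xq by (rule mem_translate)
  show ?thesis
  proof (cases "z \<in> ?D")
    case True
    have "x \<in> X \<Longrightarrow> z + x \<in> X" for x
      using subgroup_4_add[OF True, of "u + x"] unfolding XD by (simp only: ac_simps)
    then have "(+) z ` X \<subseteq> X" by blast
    then have "(+) z ` X = X" by (intro card_subset_eq) auto
    then show ?thesis by simp
  next
    case False
    have "z + x \<notin> X" if "x \<in> X" for x
    proof
      assume "z + x \<in> X"
      then have "(u + (z + x)) + (u + x) \<in> ?D" using that unfolding XD by (rule subgroup_4_add)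
      moreover have "(u + (z + x)) + (u + x) = z" by (simp add: ac_simps)
      ultimately show False using False by metis
    qed
    then have "(+) z ` X \<subseteq> - X" by blast
    moreover have "card (- X) = 4" using X by (simp add: Compl_eq_Diff_UNIV card_Diff_subset card_field)
    ultimately have "(+) z ` X = - X" using X(1) by (intro card_subset_eq) auto
    then show ?thesis by simp
  qed
qed

lemma zero_sum_translation_orbit:
  assumes X: "card X = 4" "\<Sum>X = (0 :: 'f)"
  shows "translation_orbit X = {X, - X}"
proof -
  obtain u where u: "u \<in> X" using X(1) by fastforce
  obtain v where v: "v \<notin> X" using ex_not_in[of X] X(1) by auto
  have "v \<in> (+) (u + v) ` X" using u by (simp add: mem_translate ac_simps)
  then have "(+) (u + v) ` X = - X" using zero_sum_translate[OF X] v by blast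
  then have "- X \<in> translation_orbit X" unfolding translation_orbit_iff by metis
  moreover have "translation_orbit X \<subseteq> {X, - X}"
    using zero_sum_translate[OF X] unfolding translation_orbit_def by blast
  ultimately show ?thesis using translation_orbit_self[of X] by blast
qed

lemma zero_sum_orbit_span:
  assumes X: "card X = 4" "\<Sum>X = (0 :: 'f)"
  shows "orbit_span (translation_orbit X) = {{}, X, - X, UNIV}"
proof
  show "orbit_span (translation_orbit X) \<subseteq> {{}, X, - X, UNIV}"
    unfolding zero_sum_translation_orbit[OF X]
    by (rule orbit_span_minimal) (auto simp: sym_diff_closed_def)
  have "X \<in> orbit_span (translation_orbit X)" "- X \<in> orbit_span (translation_orbit X)"
    by (auto intro!: orbit_span_superset simp: zero_sum_translation_orbit[OF X])
  moreover from this have "sym_diff X (- X) \<in> orbit_span (translation_orbit X)"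
      "sym_diff X X \<in> orbit_span (translation_orbit X)"
    using sym_diff_closedD[OF orbit_span_closed] by metis+
  moreover have "sym_diff X (- X) = UNIV" "sym_diff X X = {}" by auto
  ultimately show "{{}, X, - X, UNIV} \<subseteq> orbit_span (translation_orbit X)" by auto
qed

lemma trivial_translation_orbit:
  assumes "X = {} \<or> X = (UNIV :: 'f set)"
  shows "translation_orbit X = {X}" "orbit_span (translation_orbit X) = {{}, X}"
proof -
  show eq: "translation_orbit X = {X}"
    using assms by (auto simp: translation_orbit_def)
  have "X \<in> orbit_span {X}" "{} \<in> orbit_span {X}"
    by (auto intro: orbit_span_superset empty_in_orbit_span)
  moreover have "orbit_span {X} \<subseteq> {{}, X}"
    by (rule orbit_span_minimal) (auto simp: sym_diff_closed_def)
  ultimately show "orbit_span (translation_orbit X) = {{}, X}" unfolding eq by blast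
qed

text \<open>A four-element set of sum \<open>x \<noteq> 0\<close> meets every coset of \<open>{0, x}\<close> in one point, for if it contained
  a whole coset then its other two elements would have sum \<open>0\<close>.\<close>
lemma sum_orbit_transversal:
  assumes X: "card X = 4" "\<Sum>X = x" and x: "x \<noteq> (0 :: 'f)"
  shows "w \<in> X \<longleftrightarrow> x + w \<notin> X"
proof -
  have no: "x + y \<notin> X" if y: "y \<in> X" for y
  proof
    assume "x + y \<in> X"
    then obtain r s where rs: "X = {y, x + y, r, s}" "r \<notin> {y, x + y}" "s \<notin> {y, x + y, r}"
      using card_4_pairE[OF X(1) y] x by (metis add_0_left add_right_cancel)
    then have "y + (x + y + (r + s)) = x" using X(2) x by auto
    then have "x + (r + s) = x" by (simp add: ac_simps)
    then show False using rs by simp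
  qed
  then have "X \<inter> (+) x ` X = {}" by auto
  then have "card (X \<union> (+) x ` X) = 8" using X(1) by (simp add: card_Un_disjoint)
  then have "X \<union> (+) x ` X = UNIV" by (metis card_field card_subset_eq finite_class.finite_UNIV subset_UNIV)
  then have "w \<in> X \<or> x + w \<in> X" using mem_translate[of w x X] by blast
  then show ?thesis using no by blast
qed

text \<open>Two transversals of the cosets of \<open>{0, x}\<close> with the same sum differ in an even number of
  cosets. If the cosets of \<open>r\<close> and \<open>s\<close> in \<open>{p, q, r, s}\<close> are changed, then the translation is by
  \<open>p + q\<close>, because \<open>p + q + r = x + s\<close>.\<close>
lemma sum_orbit_eq_translation_orbit:
  assumes X: "card X = 4" "\<Sum>X = x" and x: "x \<noteq> (0 :: 'f)"
  shows "sum_orbit x = translation_orbit X"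
proof
  show "translation_orbit X \<subseteq> sum_orbit x"
    using X by (auto simp: sum_orbit_def translation_orbit_iff sum_translate)
  show "sum_orbit x \<subseteq> translation_orbit X"
  proof
    fix Y assume "Y \<in> sum_orbit x"
    then have Y: "card Y = 4" "\<Sum>Y = x" by (auto simp: sum_orbit_def)
    obtain p q where pq: "p \<in> X" "q \<in> X" "p \<noteq> q"
      using X(1) by (metis card_4_otherE)
    obtain r s where Xs: "X = {p, q, r, s}" "r \<notin> {p, q}" "s \<notin> {p, q, r}"
      using card_4_pairE[OF X(1) pq] by blast
    then have distinct: "p \<notin> {q, r, s}" "q \<notin> {r, s}" "r \<notin> {s}" using pq(3) by auto
    then have xs: "x = p + q + r + s" using X(2) unfolding Xs(1) by (simp add: add.assoc)
    \<comment> \<open>The point of \<open>Y\<close> in the coset of \<open>w\<close> is \<open>e w + w\<close>.\<close>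
    define e where "e w = (if w \<in> Y then 0 else x)" for w
    have e: "e w + w \<in> Y" for w
      using sum_orbit_transversal[OF Y x, of w] by (simp add: e_def)
    have apart: "e v + v \<noteq> e w + w" if "v \<in> X" "w \<in> X" "v \<noteq> w" for v w
    proof
      assume "e v + v = e w + w"
      then have "v = w \<or> v = x + w"
        by (auto simp: e_def split: if_splits)
      then show False using sum_orbit_transversal[OF X x, of w] that by auto
    qed
    have inj: "inj_on (\<lambda>w. e w + w) X" using apart by (auto intro: inj_onI)
    have Y'': "Y = (\<lambda>w. e w + w) ` X"
      using e X(1) Y(1) by (intro card_subset_eq[symmetric]) (auto simp: card_image[OF inj])
    then have Y': "Y = {e p + p, e q + q, e r + r, e s + s}" unfolding Xs(1) by simp
    have "\<Sum>Y = sum e X + \<Sum>X" unfolding Y'' by (simp add: sum.reindex[OF inj] sum.distrib)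
    then have "sum e X = 0" unfolding X(2) Y(2) by simp
    then have parity: "e p + e q + e r + e s = 0"
      using distinct unfolding Xs(1) by (simp add: add.assoc)
    have swap: "{a, b, x + c, x + d} = (+) (a + b) ` {a, b, c, d}" if "x = a + b + c + d" for a b c d
    proof -
      have "x + c = a + b + d" "x + d = a + b + c" unfolding that by (simp_all add: ac_simps)
      moreover have "a + b + a = b" "a + b + b = a" by (simp_all add: ac_simps)
      ultimately show ?thesis by auto
    qed
    have c: "e w = 0 \<or> e w = x" for w by (simp add: e_def)
    consider "e p = 0" "e q = 0" "e r = 0" "e s = 0" | "e p = x" "e q = x" "e r = x" "e s = x"
      | "e p = 0" "e q = 0" "e r = x" "e s = x" | "e p = x" "e q = x" "e r = 0" "e s = 0"
      | "e p = 0" "e q = x" "e r = 0" "e s = x" | "e p = x" "e q = 0" "e r = x" "e s = 0"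
      | "e p = 0" "e q = x" "e r = x" "e s = 0" | "e p = x" "e q = 0" "e r = 0" "e s = x"
      using parity x c[of p] c[of q] c[of r] c[of s] by (elim disjE) auto
    then have "\<exists>z. Y = (+) z ` X"
    proof cases
      case 1
      then show ?thesis using Y' Xs(1) by (intro exI[of _ 0]) simp
    next
      case 2
      then show ?thesis using Y' Xs(1) by (intro exI[of _ x]) simp
    next
      case 3
      then have "Y = {p, q, x + r, x + s}" "X = {p, q, r, s}" using Y' Xs(1) by auto
      then show ?thesis using swap[of p q r s] xs by metis
    next
      case 4
      then have "Y = {r, s, x + p, x + q}" "X = {r, s, p, q}" using Y' Xs(1) by auto
      moreover have "x = r + s + p + q" unfolding xs by (simp only: ac_simps)
      ultimately show ?thesis using swap[of r s p q] by metis
    next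
      case 5
      then have "Y = {p, r, x + q, x + s}" "X = {p, r, q, s}" using Y' Xs(1) by auto
      moreover have "x = p + r + q + s" unfolding xs by (simp only: ac_simps)
      ultimately show ?thesis using swap[of p r q s] by metis
    next
      case 6
      then have "Y = {q, s, x + p, x + r}" "X = {q, s, p, r}" using Y' Xs(1) by auto
      moreover have "x = q + s + p + r" unfolding xs by (simp only: ac_simps)
      ultimately show ?thesis using swap[of q s p r] by metis
    next
      case 7
      then have "Y = {p, s, x + q, x + r}" "X = {p, s, q, r}" using Y' Xs(1) by auto
      moreover have "x = p + s + q + r" unfolding xs by (simp only: ac_simps)
      ultimately show ?thesis using swap[of p s q r] by metis
    next
      case 8
      then have "Y = {q, r, x + p, x + s}" "X = {q, r, p, s}" using Y' Xs(1) by auto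
      moreover have "x = q + r + p + s" unfolding xs by (simp only: ac_simps)
      ultimately show ?thesis using swap[of q r p s] by metis
    qed
    then show "Y \<in> translation_orbit X" unfolding translation_orbit_iff .
  qed
qed

lemma sum_orbit_nonempty:
  assumes "x \<noteq> (0 :: 'f)"
  obtains X where "card X = 4" "\<Sum>X = x"
proof -
  have "card {0, x} < 8" using card_insert_le_m1 by (simp add: card_insert_if)
  then obtain a where a: "a \<notin> {0, x}" using ex_not_in by blast
  have "card {0, x, a, a + x} < 8" by (simp add: card_insert_if)
  then obtain b where b: "b \<notin> {0, x, a, a + x}" using ex_not_in by blast
  have distinct: "0 \<noteq> a" "0 \<noteq> b" "a \<noteq> b" "a + b + x \<noteq> 0" "a + b + x \<noteq> a" "a + b + x \<noteq> b"
    using a b by (auto simp: ac_simps)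
  show thesis
    using distinct by (intro that[of "{0, a, b, a + b + x}"]) (auto simp: ac_simps)
qed

section \<open>Classification of the orders\<close>

text \<open>Identify subsets of the field with elements of its group algebra over the field with two
  elements. After a translation \<open>X = {0, a, b, c}\<close>; let it correspond to \<open>u\<close>, and \<open>Y\<close> to \<open>y\<close>. The
  intersections of \<open>Y\<close> with the translates of \<open>X\<close> being even means \<open>u y = 0\<close>. The linear map that
  sends \<open>e\<^sup>z\<close> to \<open>e\<^bsup>z + a\<^esup>\<close> if \<open>z\<close> is outside the subgroup \<open>W\<close> generated by \<open>b\<close> and \<open>c\<close>, and to
  \<open>0\<close> otherwise, is a derivation \<open>D\<close> with \<open>D u = 1\<close>. Hence \<open>y = D (u y) + u (D y) = u (D y)\<close> is a
  multiple of \<open>u\<close>, that is, a sum of translates of \<open>X\<close>.\<close>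
lemma orthogonal_mem_orbit_span:
  fixes X Y :: "'f set"
  assumes X: "card X = 4" "\<Sum>X \<noteq> 0" and orth: "\<And>z. even (card ((+) z ` X \<inter> Y))"
  shows "Y \<in> orbit_span (translation_orbit X)"
proof -
  obtain u where u: "u \<in> X" by (rule card_4_otherE[OF X(1)])
  let ?X = "(+) u ` X"
  have orbit: "translation_orbit ?X = translation_orbit X"
    by (intro translation_orbit_eq translate_in_translation_orbit)
  have "0 \<in> ?X" using u by (simp add: mem_translate)
  have card: "card ?X = 4" using X(1) by simp
  obtain a where "a \<in> ?X" "a \<noteq> 0" by (rule card_4_otherE[OF card])
  then have "0 \<noteq> a" by simp
  obtain b c where abc: "?X = {0, a, b, c}" "b \<notin> {0, a}" "c \<notin> {0, a, b}"
    by (rule card_4_pairE[OF card \<open>0 \<in> ?X\<close> \<open>a \<in> ?X\<close> \<open>0 \<noteq> a\<close>])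
  have "\<Sum>?X \<noteq> 0" using X by (simp add: sum_translate)
  moreover have "0 \<notin> {a, b, c}" "a \<notin> {b, c}" "b \<notin> {c}" using abc(2,3) \<open>0 \<noteq> a\<close> by auto
  ultimately have "a + (b + c) \<noteq> 0" unfolding abc(1) by simp
  define W where "W = {0, b, c, b + c}"
  have a: "a \<notin> W" using abc(2,3) \<open>0 \<noteq> a\<close> \<open>a + (b + c) \<noteq> 0\<close> by (auto simp: W_def)
  have cancel: "u + v + v = u" for u v :: 'f by (simp add: add.assoc)
  have W: "b \<in> W" "c \<in> W" by (simp_all add: W_def)
  have W_add: "v + w \<in> W" if "v \<in> W" "w \<in> W" for v w
    using that unfolding W_def by (rule subgroup_4_add)
  have outside: "a + v \<notin> W" if "v \<in> W" for v
    using W_add[of "a + v" v] that a unfolding cancel by blast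
  have inside: "a + v \<in> W" if "v \<notin> W" for v
    unfolding W_def
    by (rule subgroup_4_complement) (use that a abc(2,3) in \<open>simp_all add: W_def\<close>)
  \<comment> \<open>The sum of the sets \<open>g z\<close> over \<open>z \<in> Y - W\<close> is \<open>u (D y)\<close>.\<close>
  define g where "g z = (+) (z + a) ` ?X" for z
  have coset: "z \<in> (+) (w + a) ` ?X \<longleftrightarrow> w \<in> g z" for w z
    unfolding g_def mem_translate by (simp only: ac_simps)
  have coset_eq: "(+) (w + a) ` ?X = {w, a + w, a + (w + b), a + (w + c)}" for w
  proof -
    have "w + a + 0 = a + w" "w + a + a = w" "w + a + b = a + (w + b)" "w + a + c = a + (w + c)"
      by (simp_all add: ac_simps)
    then show ?thesis unfolding abc(1) image_insert image_empty by (simp only: insert_commute)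
  qed
  have "w \<in> Y \<longleftrightarrow> odd (card {z \<in> Y - W. w \<in> g z})" for w
  proof -
    have Z: "{z \<in> Y - W. w \<in> g z} = ((+) (w + a) ` ?X \<inter> Y) - W"
      using coset by blast
    show ?thesis
    proof (cases "w \<in> W")
      case False
      have "w + b \<notin> W" "w + c \<notin> W"
        using False W W_add[of "w + b" b] W_add[of "w + c" c] unfolding cancel by blast+
      then have eq: "((+) (w + a) ` ?X \<inter> Y) - W = {w} \<inter> Y"
        unfolding coset_eq using inside[of "w + b"] inside[of "w + c"] inside[of w] False by blast
      show ?thesis unfolding Z eq by (cases "w \<in> Y") simp_all
    next
      case True
      have "w + b \<in> W" "w + c \<in> W"
        using True W W_add by blast+
      then have eq: "((+) (w + a) ` ?X \<inter> Y) - W = ((+) (w + a) ` ?X \<inter> Y) - {w}"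
        unfolding coset_eq using outside[of "w + b"] outside[of "w + c"] outside[of w] True by blast
      have even: "even (card ((+) (w + a) ` ?X \<inter> Y))"
        unfolding translate_translate by (rule orth)
      have "w \<in> (+) (w + a) ` ?X" unfolding coset_eq by simp
      then have "card ((+) (w + a) ` ?X \<inter> Y) = Suc (card (((+) (w + a) ` ?X \<inter> Y) - {w}))"
        if "w \<in> Y" using that by (intro card.remove) auto
      then show ?thesis unfolding Z eq using even by (cases "w \<in> Y") simp_all
    qed
  qed
  then have "Y = {w. odd (card {z \<in> Y - W. w \<in> g z})}" by blast
  also have "\<dots> \<in> orbit_span (translation_orbit ?X)"
  proof (rule sum_comb_in_sym_diff_closed[OF orbit_span_closed])
    show "{} \<in> orbit_span (translation_orbit ?X)"
      using translation_orbit_self by (intro empty_in_orbit_span) blast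
    show "g z \<in> orbit_span (translation_orbit ?X)" for z
      unfolding g_def by (intro orbit_span_superset translate_in_translation_orbit)
  qed simp
  finally show ?thesis by (simp only: orbit)
qed

lemma order_nonzero_sum:
  fixes S :: "(rat, 'f) octo set"
  assumes S: "integral_order S" and X: "X \<in> halving_set ` S" "\<Sum>X \<noteq> 0"
  shows "S = code_order (orbit_span (translation_orbit X))"
proof -
  let ?C = "halving_set ` S"
  note C = integral_order_code[OF S]
  have "orbit_span (translation_orbit X) \<subseteq> ?C"
    using C(4)[OF X(1)] by (intro orbit_span_minimal C(2)) (auto simp: translation_orbit_def)
  moreover have "?C \<subseteq> orbit_span (translation_orbit X)"
  proof
    fix Y assume "Y \<in> ?C"
    then show "Y \<in> orbit_span (translation_orbit X)"
      using C(4,6) X card_4_if_sum_nonzero[OF C(5)[OF X(1)] X(2)]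
      by (intro orthogonal_mem_orbit_span) auto
  qed
  ultimately have "?C = orbit_span (translation_orbit X)" by blast
  then show ?thesis using C(1) by simp
qed

text \<open>Two different subgroups of order four through \<open>p\<close> may not belong to the same order, although
  all intersections of their translates have even size. If \<open>z = y + (y + z)\<close> with \<open>y\<close> in the first
  subgroup and \<open>y + z\<close> in the second, then the only other such representation is the one with
  \<open>p + y\<close> in the place of \<open>y\<close>; so \<open>z\<close> is in the halving set of the product exactly when these two
  contributions have the same sign. The sum of this set is computed with indicator functions,
  which are expressed through the trace.\<close>
lemma halving_set_product_subgroups_4:
  fixes p q r :: 'f
  assumes p: "p \<noteq> 0" and q: "q \<notin> {0, p}" and r: "r \<notin> {0, p, q, p + q}"
  shows "\<Sum>(halving_set (half_e_set {0, p, q, p + q} \<odot> half_e_set {0, p, r, p + r})) = p"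
proof -
  let ?V = "{0, p, q, p + q}" and ?W = "{0, p, r, p + r}"
  let ?H = "halving_set (half_e_set ?V \<odot> half_e_set ?W)"
  define \<tau> where "\<tau> x y = tr (y * x ^ 6)" for x y :: 'f
  have \<tau>_add: "\<tau> x (y + z) = \<tau> x y + \<tau> x z" for x y z
    by (simp add: \<tau>_def distrib_right tr_add)
  have \<tau>_0: "\<tau> 0 y = 0" "\<tau> x 0 = 0" for x y by (simp_all add: \<tau>_def)
  have \<tau>_cases: "\<tau> x y = 0 \<or> \<tau> x y = 1" for x y
    unfolding \<tau>_def by (rule tr_cases)
  have \<tau>_p: "\<tau> p p = 1" using power_7[OF p] by (simp add: \<tau>_def flip: power_Suc)
  have \<tau>_q: "\<tau> (p + q) p = 1 + \<tau> q p"
    using tr_composition[OF p, of q] by (simp add: \<tau>_def add_eq_iff add.commute)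
  have \<tau>_r: "\<tau> (p + q) r = 1 + \<tau> p r + \<tau> q r"
    using tr_subgroup[OF p q r] by (simp add: \<tau>_def add_eq_iff ac_simps)
  have meet: "?V \<inter> ?W = {0, p}"
    using q r by auto
  have ind: "(if z \<in> ?H then 1 else 0) = 1 + \<tau> y (y + z) + \<tau> (p + y) (p + (y + z))"
    if y: "y \<in> ?V" "y + z \<in> ?W" for y z
  proof -
    have V: "p + y \<in> ?V" by (rule subgroup_4_add) (use y(1) in simp_all)
    have "p + (y + z) \<in> ?W" by (rule subgroup_4_add) (use y(2) in simp_all)
    then have W: "p + y + z \<in> ?W" by (simp only: add.assoc)
    have pair: "{x \<in> ?V. x + z \<in> ?W} = {y, p + y}"
    proof
      show "{y, p + y} \<subseteq> {x \<in> ?V. x + z \<in> ?W}"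
        unfolding insert_subset by (intro conjI CollectI y V W empty_subsetI)
      show "{x \<in> ?V. x + z \<in> ?W} \<subseteq> {y, p + y}"
      proof
        fix x assume "x \<in> {x \<in> ?V. x + z \<in> ?W}"
        then have "x + y \<in> ?V" "(x + z) + (y + z) \<in> ?W"
          using subgroup_4_add[OF _ y(1), of x] subgroup_4_add[OF _ y(2), of "x + z"] by blast+
        moreover have "(x + z) + (y + z) = x + y" by (simp add: ac_simps)
        ultimately have "x + y \<in> ?V \<inter> ?W" by (simp only: Int_iff)
        then have "x + y \<in> {0, p}" unfolding meet .
        then show "x \<in> {y, p + y}" by (auto simp: add_eq_iff ac_simps)
      qed
    qed
    have "(half_e_set ?V \<odot> half_e_set ?W) $ z
        = (\<Sum>x\<in>UNIV. if x \<in> {x \<in> ?V. x + z \<in> ?W} then octo_sign x (x + z) / 4 else 0)"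
      unfolding octo_mult_nth by (intro sum.cong) (auto simp: half_e_set_nth add.commute)
    also have "\<dots> = (\<Sum>x\<in>{y, p + y}. octo_sign x (x + z) / 4)"
      unfolding pair by (simp only: sum.inter_restrict[OF finite, symmetric] Int_UNIV_left)
    also have "\<dots> = (octo_sign y (y + z) + octo_sign (p + y) (p + (y + z))) / 4"
      using p by (simp add: add_divide_distrib add.assoc)
    finally have "z \<in> ?H \<longleftrightarrow> (octo_sign y (y + z) + octo_sign (p + y) (p + (y + z))) / 4 \<notin> (\<int> :: rat set)"
      by (simp only: halving_set_iff)
    also have "\<dots> \<longleftrightarrow> \<tau> y (y + z) = \<tau> (p + y) (p + (y + z))"
    proof -
      have half: "(1 / 2 :: rat) \<notin> \<int>"
        using halving_set_half_e_set[of "{0 :: 'f}"] by (auto simp: halving_set_def half_e_set_nth split: if_splits)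
      then have "(- 1 / 2 :: rat) \<notin> \<int>" by (metis minus_divide_left minus_in_Ints_iff)
      then show ?thesis
        using half \<tau>_cases[of y "y + z"] \<tau>_cases[of "p + y" "p + (y + z)"]
        by (auto simp: octo_sign_def \<tau>_def)
    qed
    finally show ?thesis
      using \<tau>_cases[of y "y + z"] \<tau>_cases[of "p + y" "p + (y + z)"] by auto
  qed
  define i where "i z = (if z \<in> ?H then 1 else 0 :: 'f)" for z
  note i = ind[folded i_def]
  have i_values: "i p = 1" "i q = \<tau> q p" "i (p + q) = 1 + \<tau> q p" "i r = \<tau> p r" "i (p + r) = 1 + \<tau> p r"
    "i (q + r) = 1 + \<tau> p r + \<tau> q p" "i (p + (q + r)) = \<tau> p r + \<tau> q p"
    using i[of 0 p] i[of q q] i[of q "p + q"] i[of 0 r] i[of 0 "p + r"] i[of q "q + r"] i[of q "p + (q + r)"]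
    by (simp_all add: \<tau>_add \<tau>_0 \<tau>_p \<tau>_q \<tau>_r ac_simps)
  have univ: "UNIV = ?V \<union> (+) r ` ?V"
  proof -
    have "v \<in> ?V \<union> (+) r ` ?V" for v
      using subgroup_4_complement[OF p q r, of v] by (cases "v \<in> ?V") (auto simp only: Un_iff mem_translate)
    then show ?thesis by blast
  qed
  have "\<Sum>?H = (\<Sum>z\<in>UNIV. i z * z)"
    by (simp add: i_def if_distrib[of "\<lambda>u. u * _"] sum.If_cases cong: if_cong)
  also have "\<dots> = (\<Sum>z\<in>?V. i z * z) + (\<Sum>z\<in>?V. i (r + z) * (r + z))"
  proof -
    have "?V \<inter> (+) r ` ?V = {}"
    proof -
      have "r + v \<notin> ?V" if "v \<in> ?V" for v
        using subgroup_4_add[of "r + v" p q v] that r by (metis add.commute add_self_left add.left_commute)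
      then show ?thesis unfolding disjoint_iff mem_translate by blast
    qed
    then show ?thesis
      unfolding univ by (subst sum.union_disjoint) (simp_all only: sum.reindex inj_on_add o_def finite.intros finite_imageI)
  qed
  also have "\<dots> = p"
  proof -
    have "0 \<notin> {p, q, p + q}" "p \<notin> {q, p + q}" "q \<notin> {p + q}" using p q by auto
    then have expand: "(\<Sum>z\<in>?V. g z) = g 0 + (g p + (g q + g (p + q)))" for g :: "'f \<Rightarrow> 'f"
      by simp
    show ?thesis
      unfolding expand by (simp add: i_values algebra_simps)
  qed
  finally show ?thesis .
qed

text \<open>The code of an order is the span of one orbit: the case of a nonzero sum is settled by
  orthogonality, and otherwise two cosets in the code have the same direction. In the latter case even
  intersections make two different subgroups meet in some \<open>p \<noteq> 0\<close>.\<close>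
lemma integral_order_classification:
  fixes S :: "(rat, 'f) octo set"
  assumes S: "integral_order S"
  obtains X where "X \<in> Hsets" "S = code_order (orbit_span (translation_orbit X))"
proof -
  let ?C = "halving_set ` S"
  note C = integral_order_code[OF S]
  consider (nonzero) X where "X \<in> ?C" "\<Sum>X \<noteq> 0"
    | (plane) P where "\<And>X. X \<in> ?C \<Longrightarrow> \<Sum>X = 0" "P \<in> ?C" "card P = 4"
    | (trivial) "?C \<subseteq> {{}, UNIV}"
    using C(5) Hsets_cases by blast
  then show thesis
  proof cases
    case nonzero
    then show thesis using order_nonzero_sum[OF S] C(5) that by blast
  next
    case trivial
    then have "?C = {{}, {}} \<or> ?C = {{}, UNIV}" using C(3) by blast
    then have "?C = orbit_span (translation_orbit {}) \<or> ?C = orbit_span (translation_orbit UNIV)"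
      using trivial_translation_orbit(2) by metis
    moreover have "{} \<in> Hsets" "(UNIV :: 'f set) \<in> Hsets"
      by (simp_all add: Hsets_def card_field)
    ultimately show thesis using C(1) that by metis
  next
    case (plane P)
    note zero = plane(1) and P = plane(2,3)
    have "?C \<subseteq> {{}, P, - P, UNIV}"
    proof
      fix Q assume Q: "Q \<in> ?C"
      show "Q \<in> {{}, P, - P, UNIV}"
      proof (rule ccontr)
        assume other: "Q \<notin> {{}, P, - P, UNIV}"
        then have Q4: "card Q = 4" using Hsets_cases[OF C(5)[OF Q]] by auto
        obtain u v where u: "u \<in> P" and v: "v \<in> Q" using P(2) Q4 by fastforce
        let ?V = "(+) u ` P" and ?W = "(+) v ` Q"
        have V: "?V \<in> ?C" "card ?V = 4" "0 \<in> ?V" and W: "?W \<in> ?C" "card ?W = 4" "0 \<in> ?W"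
          using C(4) P Q Q4 u v by (auto simp: mem_translate)
        have "?V \<noteq> ?W"
        proof
          assume "?V = ?W"
          then have "Q = (+) (v + u) ` P"
            by (metis add_self_left translate_translate translation_orbit_self mem_translate set_eq_iff)
          then show False using zero_sum_translate[OF P(2) zero[OF P(1)], of "v + u"] other by auto
        qed
        have "even (card (?V \<inter> ?W))" using C(6) V W by blast
        then have "?V \<inter> ?W \<noteq> {0}" by (metis card_1_singleton_iff odd_one One_nat_def)
        then obtain p where p: "p \<in> ?V" "p \<in> ?W" "p \<noteq> 0" using V W by blast
        obtain q where q: "q \<notin> {0, p}" "?V = {0, p, q, p + q}"
          using zero_sum_form[OF V(2) zero[OF V(1)] V(3), of p] p by auto
        obtain r where r: "r \<notin> {0, p}" "?W = {0, p, r, p + r}"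
          using zero_sum_form[OF W(2) zero[OF W(1)] W(3), of p] p by auto
        have "r \<notin> ?V"
        proof
          assume "r \<in> ?V"
          then have "?W \<subseteq> ?V" unfolding q(2) r(2) by auto
          then have "?W = ?V" using V W by (intro card_subset_eq) auto
          then show False using \<open>?V \<noteq> ?W\<close> by simp
        qed
        then have sum: "\<Sum>(halving_set (half_e_set ?V \<odot> half_e_set ?W)) = p"
          unfolding q(2) r(2) by (intro halving_set_product_subgroups_4 p q)
        have "half_e_set ?V \<in> S" "half_e_set ?W \<in> S"
          using V W by (subst C(1), simp add: half_e_set_code_order)+
        then have "half_e_set ?V \<odot> half_e_set ?W \<in> S"
          using S by (auto simp: integral_order_def octo_subring_def)
        then show False using zero sum p by blast
      qed
    qed
    moreover have "orbit_span (translation_orbit P) \<subseteq> ?C"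
      using C(4)[OF P(1)] by (intro orbit_span_minimal C(2)) (auto simp: translation_orbit_def)
    ultimately have "?C = orbit_span (translation_orbit P)"
      using zero_sum_orbit_span[OF P(2) zero[OF P(1)]] by (metis subset_antisym)
    then show thesis using C(1,5) P that by metis
  qed
qed

text \<open>All sums in the span of the orbit of \<open>X\<close> are \<open>0\<close> or the sum of \<open>X\<close>, so a nonzero sum can be read
  off from the span, and it determines the orbit. If the sum is \<open>0\<close>, then the only sets in the span
  besides the empty and the full one are \<open>X\<close> and its complement.\<close>
lemma translation_orbit_eq_if_orbit_span_eq:
  assumes X: "X \<in> Hsets" "Y \<in> (Hsets :: 'f set set)"
    and eq: "orbit_span (translation_orbit X) = orbit_span (translation_orbit Y)"
  shows "translation_orbit X = translation_orbit Y"
proof -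
  have mem: "X \<in> orbit_span (translation_orbit Y)" "Y \<in> orbit_span (translation_orbit X)"
    using eq by (auto intro: orbit_span_superset translation_orbit_self)
  then have sums: "\<Sum>X \<in> {0, \<Sum>Y}" "\<Sum>Y \<in> {0, \<Sum>X}" using orbit_span_sum X by blast+
  show ?thesis
  proof (cases "\<Sum>X = 0")
    case False
    then have "\<Sum>Y = \<Sum>X" using sums by auto
    then show ?thesis
      using X False card_4_if_sum_nonzero sum_orbit_eq_translation_orbit by metis
  next
    case True
    then have Y0: "\<Sum>Y = 0" using sums by auto
    have trivial: "Y = X" if Y: "Y = {} \<or> Y = UNIV" "X = {} \<or> X = UNIV"
      using mem trivial_translation_orbit(2)[OF Y(1)] trivial_translation_orbit(2)[OF Y(2)] Y by auto
    have four: "Z \<notin> {{}, UNIV}" if "card Z = 4" for Z :: "'f set"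
      using that card_field by auto
    have "Y \<in> translation_orbit X"
    proof (cases "card X = 4")
      case True
      then have "Y \<in> {{}, X, - X, UNIV}"
        using mem zero_sum_orbit_span[OF True \<open>\<Sum>X = 0\<close>] by simp
      moreover have "Y \<notin> {{}, UNIV}"
        using mem(1) four[OF True] trivial_translation_orbit(2)[of Y] by auto
      ultimately show ?thesis using zero_sum_translation_orbit[OF True \<open>\<Sum>X = 0\<close>] by blast
    next
      case False
      then have X': "X = {} \<or> X = UNIV" using Hsets_cases[OF X(1)] by blast
      then have "Y \<in> {{}, UNIV}" using mem(2) trivial_translation_orbit(2)[OF X'] by auto
      then show ?thesis using trivial X' translation_orbit_self by auto
    qed
    then show ?thesis using translation_orbit_eq by metis
  qed
qed

section \<open>Counting the orbits\<close>

lemma tr_sum: "tr (sum f A) = (\<Sum>i\<in>A. tr (f i :: 'f))"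
  by (induction A rule: infinite_finite_induct) (simp_all add: tr_add)

lemma trace_kernel:
  assumes "c \<noteq> (0 :: 'f)"
  shows "card {z. tr (z * c) = 0} = 4" "\<Sum>{z. tr (z * c) = 0} = 0"
proof -
  let ?K = "{z. tr (z * c) = 0}"
  have "tr (inverse c * c) = 1" using assms by simp
  then have "z \<in> - ?K \<longleftrightarrow> z \<in> (+) (inverse c) ` ?K" for z
    using tr_cases[of "z * c"] by (auto simp: mem_translate distrib_right tr_add)
  then have "- ?K = (+) (inverse c) ` ?K" by blast
  then have "card (- ?K) = card ?K" by simp
  then show card: "card ?K = 4"
    using card_Un_disjoint[of ?K "- ?K"] by (simp add: card_field)
  show "\<Sum>?K = 0"
  proof (rule ccontr)
    assume "\<Sum>?K \<noteq> 0"
    \<comment> \<open>The kernel is a subgroup, so it contains both \<open>0\<close> and its own sum, but a set of sum \<open>x \<noteq> 0\<close>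
      contains only one of \<open>0\<close> and \<open>x\<close>.\<close>
    then have "0 \<in> ?K \<longleftrightarrow> \<Sum>?K + 0 \<notin> ?K"
      by (rule sum_orbit_transversal[OF card refl])
    moreover have "tr (\<Sum>?K * c) = (\<Sum>z\<in>?K. tr (z * c))"
      by (simp only: sum_distrib_right tr_sum)
    ultimately show False by simp
  qed
qed

text \<open>The orbit contains a subgroup, and every subgroup of order four is a trace kernel.\<close>
lemma zero_sum_orbit_trace_kernel:
  assumes P: "card P = 4" "\<Sum>P = (0 :: 'f)"
  obtains c where "c \<noteq> 0" "translation_orbit P = translation_orbit {z. tr (z * c) = 0}"
proof -
  obtain u where u: "u \<in> P" by (rule card_4_otherE[OF P(1)])
  let ?V = "(+) u ` P"
  have V: "card ?V = 4" "\<Sum>?V = 0" "0 \<in> ?V"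
    using P u by (simp_all add: sum_translate mem_translate)
  obtain p where p: "p \<in> ?V" "p \<noteq> 0" by (rule card_4_otherE[OF V(1)])
  then obtain q where q: "q \<notin> {0, p}" "?V = {0, p, q, p + q}"
    using zero_sum_form[OF V, of p] by auto
  let ?c = "p ^ 6 + q ^ 6 + (p + q) ^ 6"
  have kernel: "?V = {z. tr (z * ?c) = 0}"
    unfolding q(2) using tr_subgroup_kernel[OF p(2) q(1)] by blast
  have "?c \<noteq> 0"
  proof
    assume "?c = 0"
    then have "?V = UNIV" unfolding kernel by simp
    then show False using V(1) card_field by simp
  qed
  moreover have "translation_orbit P = translation_orbit ?V"
    using translation_orbit_eq[OF translate_in_translation_orbit[of u P]] by (rule sym)
  ultimately show thesis using kernel that by metis
qed

lemma sum_orbit_eq: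
  assumes "x \<noteq> (0 :: 'f)"
  obtains X where "card X = 4" "\<Sum>X = x" "X \<in> Hsets" "sum_orbit x = translation_orbit X"
proof -
  obtain X where X: "card X = 4" "\<Sum>X = x" using sum_orbit_nonempty[OF assms] by blast
  then show thesis using that sum_orbit_eq_translation_orbit[OF X assms] by (simp add: Hsets_def)
qed

text \<open>The orbits of four-element sets are separated by the sum if it is not \<open>0\<close>; otherwise each
  contains a unique subgroup, which is the kernel of a nonzero character.\<close>
lemma card_Horbits: "card (Horbits :: 'f set set set) = 16"
proof -
  let ?N = "UNIV - {0 :: 'f}"
  define k where "k c = translation_orbit {z. tr (z * c) = 0}" for c :: 'f
  let ?A = "sum_orbit ` ?N" and ?B = "k ` ?N"
  have k: "k c = {{z. tr (z * c) = 0}, - {z. tr (z * c) = 0}}" if "c \<in> ?N" for c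
    using that trace_kernel[of c] zero_sum_translation_orbit unfolding k_def by blast
  have kernel_inj: "c = d" if "{z. tr (z * c) = 0} = {z :: 'f. tr (z * d) = 0}" for c d
  proof (rule ccontr)
    assume "c \<noteq> d"
    then have "card {z. tr (z * (c + d)) = 0} = 4" by (intro trace_kernel) simp
    moreover have "tr (z * (c + d)) = 0" for z
    proof -
      have "tr (z * c) = 0 \<longleftrightarrow> tr (z * d) = 0" using that by (simp add: set_eq_iff)
      then show ?thesis
        using tr_cases[of "z * c"] tr_cases[of "z * d"] by (auto simp: distrib_left tr_add)
    qed
    ultimately show False by (simp add: card_field)
  qed
  have sum_orbit_sum: "\<Sum>X = x" if "X \<in> sum_orbit x" for X and x :: 'f
    using that by (simp add: sum_orbit_def)
  have ne: "\<exists>X. X \<in> sum_orbit x" if "x \<in> ?N" for x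
    using that by (metis DiffD2 singletonI sum_orbit_eq translation_orbit_self)
  have k_mem: "card X = 4 \<and> \<Sum>X = 0" if "c \<in> ?N" "X \<in> k c" for c X
  proof -
    have "{z. tr (z * c) = 0} \<in> Hsets" using that(1) trace_kernel(1) by (simp add: Hsets_def)
    then show ?thesis
      using that trace_kernel[of c] translation_orbit_card translation_orbit_sum
      unfolding k_def by (metis DiffD2 singletonI)
  qed
  have inj_A: "inj_on sum_orbit ?N"
    using ne sum_orbit_sum by (intro inj_onI) metis
  have inj_B: "inj_on k ?N"
  proof (rule inj_onI)
    fix c d assume cd: "c \<in> ?N" "d \<in> ?N" "k c = k d"
    then have "{z. tr (z * c) = 0} \<in> {{z. tr (z * d) = 0}, - {z. tr (z * d) = 0}}"
      using k[of c] k[of d] by blast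
    moreover have "{z. tr (z * c) = 0} \<noteq> - {z. tr (z * d) = 0}"
      by (auto simp: set_eq_iff intro: exI[of _ 0])
    ultimately show "c = d" using kernel_inj by blast
  qed
  have card_N: "card ?N = 7" by (simp add: card_field)
  have "?A \<inter> ?B = {}"
  proof (rule ccontr)
    assume "?A \<inter> ?B \<noteq> {}"
    then obtain x c where xc: "x \<in> ?N" "c \<in> ?N" "sum_orbit x = k c" by auto
    then obtain X where "X \<in> sum_orbit x" "X \<in> k c" using ne by metis
    then show False using sum_orbit_sum[of X x] k_mem[of c X] xc by simp
  qed
  then have AB: "card (?A \<union> ?B) = 14"
    by (simp add: card_Un_disjoint card_image inj_A inj_B card_N)
  have four: "card X = 4" if "\<O> \<in> ?A \<union> ?B" "X \<in> \<O>" for \<O> X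
    using that k_mem by (auto simp: sum_orbit_def)
  have "{{}} \<notin> ?A \<union> ?B" "{UNIV} \<notin> ?A \<union> ?B"
    using four[of "{{}}" "{}"] four[of "{UNIV}" UNIV] card_field by auto
  then have "card (insert {{}} (insert {UNIV} (?A \<union> ?B))) = 16"
    using AB by simp
  moreover have "Horbits = insert {{}} (insert {UNIV} (?A \<union> ?B))"
  proof
    show "Horbits \<subseteq> insert {{}} (insert {UNIV} (?A \<union> ?B))"
    proof
      fix \<O> :: "'f set set" assume "\<O> \<in> Horbits"
      then obtain X where X: "X \<in> Hsets" "\<O> = translation_orbit X" by (auto simp: Horbits_def)
      consider "X = {}" | "X = UNIV" | "card X = 4" "\<Sum>X \<noteq> 0" | "card X = 4" "\<Sum>X = 0"
        using Hsets_cases[OF X(1)] by blast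
      then show "\<O> \<in> insert {{}} (insert {UNIV} (?A \<union> ?B))"
      proof cases
        case 3
        then have "\<O> = sum_orbit (\<Sum>X)" using X sum_orbit_eq_translation_orbit by metis
        then show ?thesis using 3 by blast
      next
        case 4
        then obtain c where "c \<noteq> 0" "\<O> = k c"
          using zero_sum_orbit_trace_kernel[of X] X unfolding k_def by metis
        then show ?thesis by blast
      qed (use X trivial_translation_orbit(1)[of X] in auto)
    qed
    have "translation_orbit ({} :: 'f set) \<in> Horbits" "translation_orbit (UNIV :: 'f set) \<in> Horbits"
      unfolding Horbits_def by (intro imageI; simp add: Hsets_def card_field)+
    then have "{{} :: 'f set} \<in> Horbits" "{UNIV :: 'f set} \<in> Horbits"
      by (simp_all add: trivial_translation_orbit(1))
    moreover have "sum_orbit x \<in> Horbits" if "x \<in> ?N" for x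
      using that sum_orbit_eq[of x] unfolding Horbits_def by (metis DiffD2 imageI singletonI)
    moreover have "k c \<in> Horbits" if "c \<in> ?N" for c
      using that trace_kernel(1)[of c] by (simp add: Horbits_def Hsets_def k_def)
    ultimately show "insert {{}} (insert {UNIV} (?A \<union> ?B)) \<subseteq> Horbits" by blast
  qed
  ultimately show ?thesis by simp
qed

lemma orbit_order_translation_orbit:
  "orbit_order (translation_orbit X) = code_order (orbit_span (translation_orbit (X :: 'f set)))"
  using translation_orbit_self by (intro orbit_order_eq_code_order) blast

lemma bij_betw_orbit_order:
  "bij_betw orbit_order (Horbits :: 'f set set set) {S. integral_order S}"
proof (rule bij_betw_imageI)
  show "inj_on orbit_order (Horbits :: 'f set set set)"
  proof (rule inj_onI)
    fix \<O> \<P> :: "'f set set"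
    assume "\<O> \<in> Horbits" "\<P> \<in> Horbits" and eq: "orbit_order \<O> = orbit_order \<P>"
    then obtain X Y where X: "X \<in> Hsets" "\<O> = translation_orbit X"
      and Y: "Y \<in> Hsets" "\<P> = translation_orbit Y" by (auto simp: Horbits_def)
    have "Z \<in> orbit_span \<O> \<longleftrightarrow> Z \<in> orbit_span \<P>" for Z
      using eq unfolding X(2) Y(2) orbit_order_translation_orbit by (metis half_e_set_code_order)
    then have "orbit_span \<O> = orbit_span \<P>" by blast
    then show "\<O> = \<P>" using translation_orbit_eq_if_orbit_span_eq X Y by metis
  qed
  show "orbit_order ` (Horbits :: 'f set set set) = {S. integral_order S}"
  proof
    show "orbit_order ` (Horbits :: 'f set set set) \<subseteq> {S. integral_order S}"
      by (auto simp: Horbits_def orbit_order_translation_orbit integral_order_orbit_span)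
    show "{S. integral_order S} \<subseteq> orbit_order ` (Horbits :: 'f set set set)"
    proof
      fix S :: "(rat, 'f) octo set" assume "S \<in> {S. integral_order S}"
      then obtain X where "X \<in> Hsets" "S = code_order (orbit_span (translation_orbit X))"
        using integral_order_classification by blast
      then show "S \<in> orbit_order ` Horbits"
        unfolding Horbits_def by (metis imageI orbit_order_translation_orbit)
    qed
  qed
qed

text \<open>By orthogonality, an order whose code contains a set of nonzero sum has only one possible
  code. A larger order would contain the same set.\<close>
lemma maximal_sum_orbit_order:
  assumes "x \<noteq> (0 :: 'f)"
  shows "maximal_integral_order (orbit_order (sum_orbit x))"
proof -
  obtain X where X: "\<Sum>X = x" "X \<in> Hsets" and orbit: "sum_orbit x = translation_orbit X"
    using sum_orbit_eq[OF assms] by blast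
  have E: "orbit_order (sum_orbit x) = code_order (orbit_span (translation_orbit X))"
    unfolding orbit by (rule orbit_order_translation_orbit)
  have "T = orbit_order (sum_orbit x)" if "integral_order T" "orbit_order (sum_orbit x) \<subseteq> T" for T
  proof -
    have "half_e_set X \<in> orbit_order (sum_orbit x)"
      unfolding E by (simp add: half_e_set_code_order orbit_span_superset translation_orbit_self)
    then have "half_e_set X \<in> T" using that(2) by blast
    then have "X \<in> halving_set ` T" by (metis halving_set_half_e_set imageI)
    then show ?thesis using order_nonzero_sum[OF that(1), of X] X assms unfolding E by simp
  qed
  moreover have "integral_order (orbit_order (sum_orbit x))"
    unfolding E by (rule integral_order_orbit_span[OF X(2)])
  ultimately show ?thesis unfolding maximal_integral_order_def by blast
qed

end

theorem theorem10:
  assumes "CARD('f::{field,finite}) = 8"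
  shows "(\<forall>\<O>\<in>(Horbits :: 'f set set set).
            integral_order (orbit_order \<O>) \<and>
            orbit_order \<O> = int_span ({octo_e z | z. True} \<union> {half_e_set X | X. X \<in> \<O>}) \<and>
            orbit_order \<O> = {a \<in> half_OZ. halving_set a \<in> orbit_span \<O>} \<and>
            (\<forall>X\<in>\<O>. orbit_order \<O> = generated_subalgebra (OZ \<union> {half_e_set X})))
       \<and> card (Horbits :: 'f set set set) = 16
       \<and> card {S :: (rat, 'f) octo set. integral_order S} = 16
       \<and> bij_betw orbit_order (Horbits :: 'f set set set) {S. integral_order S}
       \<and> (\<forall>x::'f. x \<noteq> 0 \<longrightarrow>
            sum_orbit x \<in> Horbits \<and> maximal_integral_order (orbit_order (sum_orbit x)))"
proof -
  interpret field_eight "TYPE('f)" by unfold_locales (rule assms)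
  have "integral_order (orbit_order \<O>) \<and>
      orbit_order \<O> = int_span ({octo_e z | z. True} \<union> {half_e_set X | X. X \<in> \<O>}) \<and>
      orbit_order \<O> = {a \<in> half_OZ. halving_set a \<in> orbit_span \<O>} \<and>
      (\<forall>X\<in>\<O>. orbit_order \<O> = generated_subalgebra (OZ \<union> {half_e_set X}))"
    if orbit: "\<O> \<in> Horbits" for \<O> :: "'f set set"
  proof -
    obtain X where X: "X \<in> Hsets" "\<O> = translation_orbit X" using orbit by (auto simp: Horbits_def)
    have "orbit_order \<O> = generated_subalgebra (OZ \<union> {half_e_set Y})" if Y: "Y \<in> \<O>" for Y
    proof -
      have "Y \<in> Hsets" using X Y translation_orbit_card[of Y X] by (simp add: Hsets_iff)
      moreover have "\<O> = translation_orbit Y" using X Y translation_orbit_eq by metis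
      ultimately show ?thesis by (simp only: generated_subalgebra_eq)
    qed
    moreover have "integral_order (orbit_order \<O>)"
      using X by (simp add: orbit_order_translation_orbit integral_order_orbit_span)
    moreover have "orbit_order \<O> = int_span ({octo_e z | z. True} \<union> {half_e_set X | X. X \<in> \<O>})"
      unfolding orbit_order_def by (rule arg_cong[of _ _ int_span]) blast
    moreover have "orbit_order \<O> = {a \<in> half_OZ. halving_set a \<in> orbit_span \<O>}"
      unfolding X(2) orbit_order_translation_orbit by (rule code_order_def)
    ultimately show ?thesis by blast
  qed
  moreover have "card {S :: (rat, 'f) octo set. integral_order S} = 16"
    using bij_betw_same_card[OF bij_betw_orbit_order] card_Horbits by simp
  moreover have "sum_orbit x \<in> Horbits" if "x \<noteq> 0" for x :: 'f
    using sum_orbit_eq[OF that] unfolding Horbits_def by (metis imageI)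
  ultimately show ?thesis
    using card_Horbits bij_betw_orbit_order maximal_sum_orbit_order by blast
qed

end
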